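(* For any matrix group $G$ whose matrix entries are computable numbers, $\mathfrak{L}(G)^w_{O(n)} \subsetneq \mathsf{RE}$.
   Context: For a group $G$ with identity $e$, a $G$-automaton is a tuple $(Q,\Sigma,G,\delta,q_0,Q_a)$ where $Q$ is a finite set of states, $\Sigma$ a finite input alphabet, $q_0\in Q$ the initial state, $Q_a\subseteq Q$ the accepting states, and $\delta$ assigns to each $(q,\sigma)\in Q\times(\Sigma\cup\{\varepsilon\})$ a finite set of pairs $(q',m)\in Q\times G$. The register holds an element of $G$, initially $e$; using a transition $(q',m)\in\delta(q,\sigma)$ (one step) the automaton reads $\sigma$ (or nothing), moves to $q'$ and replaces the register content $x$ by $xm$. A word is accepted if some computation reads it entirely and ends in an accepting state with register equal to $e$. A $G$-automaton recognizing $\mathtt{L}$ is weakly $t(n)$ time-bounded if every $x\in\mathtt{L}$ with $|x|=n$ has an accepting computation of at most $t(n)$ steps; $\mathfrak{L}(G)^w_{O(n)}$ is the class of languages recognized by weakly $t(n)$ time-bounded $G$-automata for some $t(n)=O(n)$. $\mathsf{RE}$ is the class of recursively enumerable languages. *)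

theory Defs
  imports "HOL-Analysis.Analysis" "HOL-Library.Nat_Bijection" "HOL-Library.Landau_Symbols"
begin

datatype instr = Inc nat nat | Dec nat nat nat

type_synonym config = "nat \<times> (nat \<Rightarrow> nat)"

definition mstep :: "instr list \<Rightarrow> config \<Rightarrow> config" where
  "mstep p c = (case c of (pc, R) \<Rightarrow>
     if pc < length p then
       (case p ! pc of
          Inc r j \<Rightarrow> (j, R(r := Suc (R r)))
        | Dec r j k \<Rightarrow> (if 0 < R r then (j, R(r := R r - 1)) else (k, R)))
     else (pc, R))"

definition init_config :: "nat \<Rightarrow> config" where
  "init_config n = (0, (\<lambda>_. 0)(0 := n))"

definition halts_on :: "instr list \<Rightarrow> nat \<Rightarrow> bool" where
  "halts_on p n \<longleftrightarrow> (\<exists>t. length p \<le> fst ((mstep p ^^ t) (init_config n)))"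

definition computable_fun :: "(nat \<Rightarrow> nat) \<Rightarrow> bool" where
  "computable_fun f \<longleftrightarrow> (\<exists>p. \<forall>n. \<exists>t.
      length p \<le> fst ((mstep p ^^ t) (init_config n)) \<and>
      snd ((mstep p ^^ t) (init_config n)) 0 = f n)"

definition re_set :: "nat set \<Rightarrow> bool" where
  "re_set S \<longleftrightarrow> (\<exists>p. \<forall>n. n \<in> S \<longleftrightarrow> halts_on p n)"

definition computable_real :: "real \<Rightarrow> bool" where
  "computable_real x \<longleftrightarrow> (\<exists>f. computable_fun f \<and>
      (\<forall>n. \<bar>x - real_of_int (int_decode (f n)) / 2 ^ n\<bar> \<le> 1 / 2 ^ n))"

definition computable_complex :: "complex \<Rightarrow> bool" where
  "computable_complex z \<longleftrightarrow> computable_real (Re z) \<and> computable_real (Im z)"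

definition matrix_group :: "(complex ^'n ^'n) set \<Rightarrow> bool" where
  "matrix_group G \<longleftrightarrow> G \<subseteq> {A. invertible A} \<and> mat 1 \<in> G \<and>
     (\<forall>A\<in>G. \<forall>B\<in>G. A ** B \<in> G) \<and> (\<forall>A\<in>G. matrix_inv A \<in> G)"

definition computable_entries :: "(complex ^'n ^'n) set \<Rightarrow> bool" where
  "computable_entries G \<longleftrightarrow> (\<forall>A\<in>G. \<forall>i j. computable_complex (A $ i $ j))"

text \<open>States are natural numbers, input symbols are natural numbers.
  A transition (q, s, q', m) with s = None is an epsilon-move, with s = Some a reads a.\<close>
type_synonym 'n trans = "nat \<times> nat option \<times> nat \<times> (complex ^'n ^'n)"

definition G_automaton ::
  "(complex ^'n ^'n) set \<Rightarrow> nat set \<Rightarrow> nat set \<Rightarrow> 'n trans set \<Rightarrow> nat \<Rightarrow> nat set \<Rightarrow> bool" where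
  "G_automaton G Q \<Sigma> \<delta> q0 Qa \<longleftrightarrow> finite Q \<and> finite \<Sigma> \<and> q0 \<in> Q \<and> Qa \<subseteq> Q \<and> finite \<delta> \<and>
     (\<forall>(q, s, q', m) \<in> \<delta>. q \<in> Q \<and> q' \<in> Q \<and> m \<in> G \<and> (\<forall>a. s = Some a \<longrightarrow> a \<in> \<Sigma>))"

inductive comp :: "('n::finite) trans set \<Rightarrow> nat \<Rightarrow> complex ^'n ^'n \<Rightarrow> nat list \<Rightarrow> nat \<Rightarrow> complex ^'n ^'n \<Rightarrow> nat \<Rightarrow> bool"
  for \<delta> where
  comp_nil: "comp \<delta> q x [] q x 0"
| comp_eps: "(q, None, q', m) \<in> \<delta> \<Longrightarrow> comp \<delta> q' (x ** m) w q'' y k \<Longrightarrow> comp \<delta> q x w q'' y (Suc k)"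
| comp_read: "(q, Some a, q', m) \<in> \<delta> \<Longrightarrow> comp \<delta> q' (x ** m) w q'' y k \<Longrightarrow> comp \<delta> q x (a # w) q'' y (Suc k)"

definition accepts_in :: "('n::finite) trans set \<Rightarrow> nat \<Rightarrow> nat set \<Rightarrow> nat list \<Rightarrow> nat \<Rightarrow> bool" where
  "accepts_in \<delta> q0 Qa w k \<longleftrightarrow> (\<exists>qf\<in>Qa. comp \<delta> q0 (mat 1) w qf (mat 1) k)"

definition lang :: "('n::finite) trans set \<Rightarrow> nat \<Rightarrow> nat set \<Rightarrow> nat list set" where
  "lang \<delta> q0 Qa = {w. \<exists>k. accepts_in \<delta> q0 Qa w k}"

definition weakly_time_bounded :: "('n::finite) trans set \<Rightarrow> nat \<Rightarrow> nat set \<Rightarrow> (nat \<Rightarrow> nat) \<Rightarrow> bool" where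
  "weakly_time_bounded \<delta> q0 Qa t \<longleftrightarrow>
     (\<forall>w \<in> lang \<delta> q0 Qa. \<exists>k \<le> t (length w). accepts_in \<delta> q0 Qa w k)"

definition lin_time_class :: "(complex ^'n ^'n) set \<Rightarrow> (nat set \<times> nat list set) set" where
  "lin_time_class G = {(\<Sigma>, L). \<exists>Q \<delta> q0 Qa t.
      G_automaton G Q \<Sigma> \<delta> q0 Qa \<and> L = lang \<delta> q0 Qa \<and>
      (\<lambda>n. real (t n)) \<in> O(\<lambda>n. real n) \<and> weakly_time_bounded \<delta> q0 Qa t}"

definition RE_class :: "(nat set \<times> nat list set) set" where
  "RE_class = {(\<Sigma>, L). finite \<Sigma> \<and> L \<subseteq> lists \<Sigma> \<and> re_set (list_encode ` L)}"

end

theory Submission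
  imports Defs
begin

text \<open>
  Every language of the class is decidable, whereas \<open>RE\<close> contains an undecidable unary language, the
  halting set of the counter machines.

  Decidability rests on the word problem for finitely many matrices \<open>A\<^sub>i\<close> over the complex numbers.
  Let \<open>t\<close> be a maximal algebraically independent family of matrix entries and \<open>R = \<int>[t]\<close>. All entries
  are algebraic over \<open>R\<close>, so they act on a finite-dimensional space over the fraction field of \<open>R\<close>;
  in a basis, and after multiplication by a common denominator \<open>g\<close>, the \<open>A\<^sub>i\<close> become matrices
  \<open>B\<^sub>i\<close> of integer polynomials in \<open>t\<close>. A product of length \<open>k\<close> is the identity iff the corresponding
  product of the \<open>B\<^sub>i\<close> is \<open>g\<^sup>k\<close> times the identity, an equality of polynomials whose degree is
  linear in \<open>k\<close>. By independence of \<open>t\<close> it can be checked on a finite grid of integer points. The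
  polynomials \<open>B\<^sub>i\<close> and \<open>g\<close> are finite data, so that no effective information about the entries enters.

  The time bound leaves finitely many computations to be searched for each input word.
\<close>

section \<open>Structured programs for counter machines\<close>

text \<open>Equality of computable numbers is undecidable: approximations can show that a register
  differs from the identity, never that it equals it. The decision procedure therefore works with
  exact algebraic data. These are obtained by pure existence arguments, separately for each
  automaton; decidability of one language asks that a program exist, not that it can be found from
  the automaton.

  One denominator \<open>g\<close> is shared by all generators, so that a word of length
  \<open>k\<close> carries the factor \<open>g^k\<close> whatever its letters are. The time bound
  \<open>t\<close> may itself be non-computable; a linear majorant of it bounds the search.

  As recursive enumerability is defined by counter machines, the arithmetic has to be programmed on
  them. Closure lemmas for total functions do this once; afterwards decidability follows the syntax
  of a formula.\<close>

datatype com = SKIP | INCR nat | DECR nat | SEQ com com | LOOP nat com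

inductive exec :: "com \<Rightarrow> (nat \<Rightarrow> nat) \<Rightarrow> (nat \<Rightarrow> nat) \<Rightarrow> bool" where
  exec_SKIP: "exec SKIP R R"
| exec_INCR: "exec (INCR r) R (R(r := Suc (R r)))"
| exec_DECR: "exec (DECR r) R (R(r := R r - 1))"
| exec_SEQ: "exec a R R' \<Longrightarrow> exec b R' R'' \<Longrightarrow> exec (SEQ a b) R R''"
| exec_LOOP_end: "R r = 0 \<Longrightarrow> exec (LOOP r c) R R"
| exec_LOOP_step: "0 < R r \<Longrightarrow> exec c (R(r := R r - 1)) R' \<Longrightarrow> exec (LOOP r c) R' R''
    \<Longrightarrow> exec (LOOP r c) R R''"

primrec clen :: "com \<Rightarrow> nat" where
  "clen SKIP = 0"
| "clen (INCR r) = 1"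
| "clen (DECR r) = 1"
| "clen (SEQ a b) = clen a + clen b"
| "clen (LOOP r c) = clen c + 3"

text \<open>The machines have no unconditional jump; the last two instructions of a compiled loop
  increment and decrement the loop register in order to jump back.\<close>
primrec compile :: "nat \<Rightarrow> com \<Rightarrow> instr list" where
  "compile i SKIP = []"
| "compile i (INCR r) = [Inc r (i + 1)]"
| "compile i (DECR r) = [Dec r (i + 1) (i + 1)]"
| "compile i (SEQ a b) = compile i a @ compile (i + clen a) b"
| "compile i (LOOP r c) = [Dec r (i + 1) (i + clen c + 3)] @ compile (i + 1) c @
     [Inc r (i + clen c + 2), Dec r i i]"

lemma length_compile [simp]: "length (compile i c) = clen c"
  by (induction c arbitrary: i) auto

definition code_at :: "instr list \<Rightarrow> nat \<Rightarrow> instr list \<Rightarrow> bool" where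
  "code_at p i xs \<longleftrightarrow> (\<exists>a b. p = a @ xs @ b \<and> length a = i)"

lemma code_at_append: "code_at p i (xs @ ys) \<Longrightarrow> code_at p i xs \<and> code_at p (i + length xs) ys"
  unfolding code_at_def by (metis append.assoc length_append)

lemma code_at_Cons: "code_at p i (x # xs) \<Longrightarrow> i < length p \<and> p ! i = x \<and> code_at p (Suc i) xs"
  unfolding code_at_def
  by (auto simp: nth_append) (metis append.assoc append_Cons append_Nil length_append_singleton)

lemma code_at_LOOP:
  "code_at p i (compile i (LOOP r c)) \<Longrightarrow> code_at p (i + 1) (compile (i + 1) c)"
  using code_at_Cons code_at_append by fastforce

lemma code_at_self: "code_at p 0 p"
  unfolding code_at_def by auto

lemma mstep_trans:
  assumes "(mstep p ^^ t) c = c'" "(mstep p ^^ t') c' = c''"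
  shows "(mstep p ^^ (t' + t)) c = c''"
  using assms by (simp add: funpow_add)

text \<open>This treats a single pass on the machine because a diverging loop has no
  \<open>exec\<close> derivation. The bound \<open>t \<ge> 1\<close> ensures that infinitely many
  passes take unboundedly many steps.\<close>

lemma mstep_LOOP_pass:
  assumes c: "code_at p i (compile i (LOOP r c))" and pos: "0 < R r"
    and body: "\<exists>t. (mstep p ^^ t) (i + 1, R(r := R r - 1)) = (i + 1 + clen c, R')"
  shows "\<exists>t\<ge>1. (mstep p ^^ t) (i, R) = (i, R')"
proof -
  have c1: "i < length p" "p ! i = Dec r (i + 1) (i + clen c + 3)"
    and c2: "code_at p (Suc i) (compile (i + 1) c @ [Inc r (i + clen c + 2), Dec r i i])"
    using code_at_Cons[of p i] c by auto
  have c3: "code_at p (Suc i + clen c) [Inc r (i + clen c + 2), Dec r i i]"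
    using code_at_append[OF c2] by simp
  note c4 = code_at_Cons[OF c3] 
  have c5: "Suc (Suc i + clen c) < length p" "p ! Suc (Suc i + clen c) = Dec r i i"
    using code_at_Cons c4 by blast+
  obtain t where t: "(mstep p ^^ t) (i + 1, R(r := R r - 1)) = (i + 1 + clen c, R')"
    using body by blast
  have s1: "(mstep p ^^ 1) (i, R) = (i + 1, R(r := R r - 1))"
    using c1 pos by (simp add: mstep_def)
  have s3: "(mstep p ^^ 2) (i + 1 + clen c, R') = (i, R')"
    using c4 c5 by (simp add: mstep_def numeral_2_eq_2)
  have "(mstep p ^^ (2 + (t + 1))) (i, R) = (i, R')"
    using mstep_trans[OF mstep_trans[OF s1 t] s3] .
  then show ?thesis by (intro exI[of _ "2 + (t + 1)"]) auto
qed

lemma compile_correct: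
  "exec c R R' \<Longrightarrow> code_at p i (compile i c) \<Longrightarrow> \<exists>t. (mstep p ^^ t) (i, R) = (i + clen c, R')"
proof (induction arbitrary: i rule: exec.induct)
  case (exec_SKIP R)
  show ?case by (intro exI[of _ 0]) simp
next
  case (exec_INCR r R)
  then show ?case using code_at_Cons[of p i]
    by (intro exI[of _ 1]) (auto simp: mstep_def)
next
  case (exec_DECR r R)
  then show ?case using code_at_Cons[of p i]
    by (intro exI[of _ 1]) (auto simp: mstep_def fun_eq_iff)
next
  case (exec_SEQ a R R' b R'')
  from exec_SEQ.prems have "code_at p i (compile i a)" "code_at p (i + clen a) (compile (i + clen a) b)"
    using code_at_append[of p i "compile i a"] by auto
  then obtain t t' where "(mstep p ^^ t) (i, R) = (i + clen a, R')"
     "(mstep p ^^ t') (i + clen a, R') = (i + clen a + clen b, R'')"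
    using exec_SEQ.IH by meson
  from mstep_trans[OF this] show ?case by (auto simp: add.assoc)
next
  case (exec_LOOP_end R r c)
  then show ?case using code_at_Cons[of p i]
    by (intro exI[of _ 1]) (auto simp: mstep_def)
next
  case (exec_LOOP_step R r c R' R'')
  have "code_at p (i + 1) (compile (i + 1) c)"
    using exec_LOOP_step.prems by (rule code_at_LOOP)
  then obtain t where "(mstep p ^^ t) (i, R) = (i, R')"
    using mstep_LOOP_pass[OF exec_LOOP_step.prems] exec_LOOP_step.hyps(1) exec_LOOP_step.IH(1) by blast
  moreover obtain t' where "(mstep p ^^ t') (i, R') = (i + clen (LOOP r c), R'')"
    using exec_LOOP_step.IH(2) exec_LOOP_step.prems by blast
  ultimately show ?case using mstep_trans by blast
qed

lemma halted_stable:
  assumes "length p \<le> fst ((mstep p ^^ t) c)" "t \<le> t'"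
  shows "length p \<le> fst ((mstep p ^^ t') c)"
  using assms(2,1)
  by (induction rule: dec_induct) (auto simp: mstep_def split: prod.splits)

text \<open>\<open>S j\<close> is the state before pass \<open>j\<close>. The body may refill
  \<open>r\<close>, so this covers while loops; \<open>exec_for\<close> is the special case of a
  counted loop.\<close>

lemma exec_LOOP_iterate:
  assumes "\<And>j. j < N \<Longrightarrow> 0 < S j r \<and> exec c ((S j)(r := S j r - 1)) (S (Suc j))"
    and "S N r = 0"
  shows "exec (LOOP r c) (S 0) (S N)"
proof -
  have "j \<le> N \<Longrightarrow> exec (LOOP r c) (S j) (S N)" for j
  proof (induction rule: inc_induct)
    case base
    then show ?case using assms(2) by (rule exec_LOOP_end)
  next
    case (step j)
    then show ?case using assms(1) exec_LOOP_step by blast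
  qed
  then show ?thesis by simp
qed

lemma exec_eq: "exec c R R'' \<Longrightarrow> R'' = R' \<Longrightarrow> exec c R R'"
  by simp

lemma exec_for:
  assumes "\<And>j. j < N \<Longrightarrow> S (Suc j) r = S j r - 1 \<and> exec c ((S j)(r := S j r - 1)) (S (Suc j))"
    and "S 0 = R" "R r = N" "S N = R'"
  shows "exec (LOOP r c) R R'"
proof -
  have "j \<le> N \<Longrightarrow> S j r = N - j" for j
    by (induction j) (use assms in auto)
  then have "exec (LOOP r c) (S 0) (S N)"
    using assms(1) by (intro exec_LOOP_iterate) auto
  then show ?thesis using assms by simp
qed

section \<open>Register transfer and the pairing function\<close>

definition moveC :: "nat \<Rightarrow> nat \<Rightarrow> com" where
  "moveC a b = LOOP a (INCR b)"

lemma exec_moveC: "a \<noteq> b \<Longrightarrow> exec (moveC a b) R (R(a := 0, b := R b + R a))"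
  unfolding moveC_def
  by (rule exec_for[where S = "\<lambda>j. R(a := R a - j, b := R b + j)" and N = "R a"])
     (auto intro!: exec_eq[OF exec_INCR] simp: fun_eq_iff)

definition clearC :: "nat \<Rightarrow> com" where
  "clearC a = LOOP a SKIP"

lemma exec_clearC: "exec (clearC a) R (R(a := 0))"
  unfolding clearC_def
  by (rule exec_for[where S = "\<lambda>j. R(a := R a - j)" and N = "R a"])
     (auto intro!: exec_eq[OF exec_SKIP] simp: fun_eq_iff)

definition copyC :: "nat \<Rightarrow> nat \<Rightarrow> nat \<Rightarrow> com" where
  "copyC a b q = SEQ (LOOP a (SEQ (INCR b) (INCR q))) (moveC q a)"

lemma exec_copyC:
  assumes "a \<noteq> b" "a \<noteq> q" "b \<noteq> q" "R q = 0"
  shows "exec (copyC a b q) R (R(b := R b + R a))"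
  unfolding copyC_def
proof (rule exec_SEQ)
  show "exec (LOOP a (SEQ (INCR b) (INCR q))) R (R(a := 0, b := R b + R a, q := R a))"
    by (rule exec_for[where S = "\<lambda>j. R(a := R a - j, b := R b + j, q := j)" and N = "R a"])
       (use assms in \<open>auto intro!: exec_eq[OF exec_SEQ[OF exec_INCR exec_INCR]] simp: fun_eq_iff\<close>)
  show "exec (moveC q a) (R(a := 0, b := R b + R a, q := R a)) (R(b := R b + R a))"
    by (rule exec_eq[OF exec_moveC]) (use assms in \<open>auto simp: fun_eq_iff\<close>)
qed

text \<open>The code of \<open>(m, n)\<close> is \<open>triangle (m + n) + m\<close>. Register
  \<open>k\<close> keeps \<open>m\<close> while \<open>k+1\<close> counts down from
  \<open>s = m + n\<close>; each pass adds the decremented counter plus one, in total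
  \<open>s + (s - 1) + ... + 1\<close>, which is \<open>triangle s\<close>.\<close>

definition encC :: "nat \<Rightarrow> com" where
  "encC k = SEQ (moveC k (k+2)) (SEQ (copyC (k+2) (k+1) (k+3))
     (SEQ (moveC (k+2) k) (LOOP (k+1) (SEQ (copyC (k+1) k (k+2)) (INCR k)))))"

lemma triangle_mono: "i \<le> j \<Longrightarrow> triangle i \<le> triangle j"
  by (rule lift_Suc_mono_le[of triangle]) auto

lemma triangle_minus:
  assumes "j < s"
  shows "Suc (triangle s - triangle (s - j) + (s - Suc j)) = triangle s - triangle (s - Suc j)"
proof -
  from assms obtain i where i: "s = Suc (i + j)" by (metis add.commute less_imp_Suc_add)
  show ?thesis using triangle_mono[of "Suc i" "Suc (i + j)"] by (simp add: i)
qed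

lemma exec_encC:
  assumes "\<And>r. r > k + 1 \<Longrightarrow> R r = 0"
  shows "exec (encC k) R (R(k := prod_encode (R k, R (k+1)), k+1 := 0))"
proof -
  define s where "s = R k + R (k+1)"
  have 1: "exec (moveC k (k+2)) R (R(k := 0, k+2 := R k))"
    by (rule exec_eq[OF exec_moveC]) (use assms in \<open>auto simp: fun_eq_iff\<close>)
  have 2: "exec (copyC (k+2) (k+1) (k+3)) (R(k := 0, k+2 := R k)) (R(k := 0, k+2 := R k, k+1 := s))"
    by (rule exec_eq[OF exec_copyC]) (use assms in \<open>auto simp: fun_eq_iff s_def\<close>)
  have 3: "exec (moveC (k+2) k) (R(k := 0, k+2 := R k, k+1 := s)) (R(k+1 := s))"
    by (rule exec_eq[OF exec_moveC]) (use assms in \<open>auto simp: fun_eq_iff\<close>)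
  define S where "S = (\<lambda>j. R(k := R k + (triangle s - triangle (s - j)), k+1 := s - j))"
  have 4: "exec (LOOP (k+1) (SEQ (copyC (k+1) k (k+2)) (INCR k))) (R(k+1 := s)) (S s)"
  proof (rule exec_for[where S = S])
    fix j assume j: "j < s"
    have "exec (copyC (k+1) k (k+2)) ((S j)(k+1 := S j (k+1) - 1))
       ((S j)(k+1 := S j (k+1) - 1, k := S j k + (S j (k+1) - 1)))"
      by (rule exec_eq[OF exec_copyC]) (use assms in \<open>auto simp: fun_eq_iff S_def\<close>)
    then have "exec (SEQ (copyC (k+1) k (k+2)) (INCR k)) ((S j)(k+1 := S j (k+1) - 1)) (S (Suc j))"
      by (rule exec_SEQ[OF _ exec_eq[OF exec_INCR]])
         (use triangle_minus[OF j] triangle_mono[of "s - Suc j" s] in \<open>simp add: fun_eq_iff S_def, linarith\<close>)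
    then show "S (Suc j) (k+1) = S j (k+1) - 1 \<and>
       exec (SEQ (copyC (k+1) k (k+2)) (INCR k)) ((S j)(k+1 := S j (k+1) - 1)) (S (Suc j))"
      by (simp add: S_def)
  qed (auto simp: S_def fun_eq_iff)
  have "S s = R(k := prod_encode (R k, R (k+1)), k+1 := 0)"
    by (auto simp: S_def fun_eq_iff prod_encode_def s_def)
  then show ?thesis unfolding encC_def
    using exec_SEQ[OF 1 exec_SEQ[OF 2 exec_SEQ[OF 3 4]]] by simp
qed

text \<open>One step along the Cantor diagonals: \<open>(m, Suc n)\<close> goes to
  \<open>(Suc m, n)\<close> and \<open>(m, 0)\<close> to \<open>(0, Suc m)\<close>. Register
  \<open>k+3\<close> is a flag that starts at 1 and is cleared by any pass of the loop on
  \<open>k+2\<close>, so it survives exactly if that component is 0.\<close>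

definition nextC :: "nat \<Rightarrow> com" where
  "nextC k = SEQ (INCR (k+3)) (SEQ (LOOP (k+2) (SEQ (DECR (k+3)) (INCR (k+4)))) (SEQ (DECR (k+4))
     (SEQ (moveC (k+4) (k+2)) (SEQ (INCR (k+1)) (LOOP (k+3) (moveC (k+1) (k+2)))))))"

lemma exec_nextC:
  assumes 0: "\<And>r. r > k + 2 \<Longrightarrow> R r = 0"
    and m: "prod_decode N = (R (k+1), R (k+2))" "prod_decode (Suc N) = (m', n')"
  shows "exec (nextC k) R (R(k+1 := m', k+2 := n'))"
proof -
  let ?n = "R (k+2)" and ?m = "R (k+1)"
  define F where "F = (if ?n = 0 then 1 else 0 :: nat)"
  have 1: "exec (INCR (k+3)) R (R(k+3 := 1))"
    by (rule exec_eq[OF exec_INCR]) (use 0 in \<open>auto simp: fun_eq_iff\<close>)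
  have 2: "exec (LOOP (k+2) (SEQ (DECR (k+3)) (INCR (k+4)))) (R(k+3 := 1)) (R(k+2 := 0, k+3 := F, k+4 := ?n))"
    by (rule exec_for[where S = "\<lambda>j. R(k+2 := ?n - j, k+3 := (if j = 0 then 1 else 0), k+4 := j)" and N = ?n])
       (use 0 in \<open>auto intro!: exec_eq[OF exec_SEQ[OF exec_DECR exec_INCR]] simp: fun_eq_iff F_def\<close>)
  have 3: "exec (DECR (k+4)) (R(k+2 := 0, k+3 := F, k+4 := ?n)) (R(k+2 := 0, k+3 := F, k+4 := ?n - 1))"
    by (rule exec_eq[OF exec_DECR]) (use 0 in \<open>auto simp: fun_eq_iff\<close>)
  have 4: "exec (moveC (k+4) (k+2)) (R(k+2 := 0, k+3 := F, k+4 := ?n - 1)) (R(k+2 := ?n - 1, k+3 := F))"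
    by (rule exec_eq[OF exec_moveC]) (use 0 in \<open>auto simp: fun_eq_iff\<close>)
  have 5: "exec (INCR (k+1)) (R(k+2 := ?n - 1, k+3 := F)) (R(k+1 := Suc ?m, k+2 := ?n - 1, k+3 := F))"
    by (rule exec_eq[OF exec_INCR]) (use 0 in \<open>auto simp: fun_eq_iff\<close>)
  \<comment> \<open>A loop on a 0/1 flag is a conditional: it makes \<open>F\<close> passes.\<close>
  define S where "S = (\<lambda>j::nat. if j = 0 then R(k+1 := Suc ?m, k+2 := ?n - 1, k+3 := F)
     else R(k+1 := 0, k+2 := Suc ?m + (?n - 1), k+3 := 0))"
  have 6: "exec (LOOP (k+3) (moveC (k+1) (k+2))) (R(k+1 := Suc ?m, k+2 := ?n - 1, k+3 := F)) (S F)"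
    by (rule exec_for[where S = S])
       (auto intro!: exec_eq[OF exec_moveC] simp: S_def F_def fun_eq_iff split: if_splits)
  have N: "N = triangle (?m + ?n) + ?m"
    using prod_decode_inverse[of N] unfolding m(1) by (simp add: prod_encode_def)
  have "Suc N = prod_encode (if ?n = 0 then (0, Suc ?m) else (Suc ?m, ?n - 1))"
    unfolding N by (cases "?n") (auto simp: prod_encode_def)
  from arg_cong[OF this, of prod_decode]
  have "(m', n') = (if ?n = 0 then (0, Suc ?m) else (Suc ?m, ?n - 1))"
    using m(2) by (simp only: prod_encode_inverse)
  then have mn: "m' = (if ?n = 0 then 0 else Suc ?m)" "n' = (if ?n = 0 then Suc ?m else ?n - 1)"
    by (simp_all split: if_splits)
  have "S F = R(k+1 := m', k+2 := n')"
    unfolding mn S_def F_def by (rule ext) (simp add: 0)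
  then show ?thesis unfolding nextC_def
    using exec_SEQ[OF 1 exec_SEQ[OF 2 exec_SEQ[OF 3 exec_SEQ[OF 4 exec_SEQ[OF 5 6]]]]] by simp
qed

text \<open>Decoding walks through the enumeration of pairs from \<open>(0, 0)\<close>, one step per
  unit of the code, instead of searching for the right diagonal.\<close>

definition decC :: "nat \<Rightarrow> com" where
  "decC k = SEQ (LOOP k (nextC k)) (SEQ (moveC (k+1) k) (moveC (k+2) (k+1)))"

definition pfst :: "nat \<Rightarrow> nat" where "pfst x = fst (prod_decode x)"
definition psnd :: "nat \<Rightarrow> nat" where "psnd x = snd (prod_decode x)"
definition pair :: "nat \<Rightarrow> nat \<Rightarrow> nat" where "pair x y = prod_encode (x, y)"

lemma pfst_pair [simp]: "pfst (pair x y) = x"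
  and psnd_pair [simp]: "psnd (pair x y) = y"
  and pair_pfst_psnd [simp]: "pair (pfst z) (psnd z) = z"
  by (auto simp: pfst_def psnd_def pair_def)

lemma pfst_psnd_0 [simp]: "pfst 0 = 0" "psnd 0 = 0"
proof -
  have "pair 0 0 = 0" by (simp add: pair_def prod_encode_def)
  then show "pfst 0 = 0" "psnd 0 = 0" by (metis pfst_pair, metis psnd_pair)
qed

lemma exec_decC:
  assumes 0: "\<And>r. r > k \<Longrightarrow> R r = 0"
  shows "exec (decC k) R (R(k := pfst (R k), k+1 := psnd (R k)))"
proof -
  let ?N = "R k"
  define S where "S = (\<lambda>j. R(k := ?N - j, k+1 := pfst j, k+2 := psnd j))"
  have 1: "exec (LOOP k (nextC k)) R (S ?N)"
  proof (rule exec_for[where S = S])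
    fix j assume j: "j < ?N"
    show "S (Suc j) k = S j k - 1 \<and> exec (nextC k) ((S j)(k := S j k - 1)) (S (Suc j))"
      by (intro conjI exec_eq[OF exec_nextC[where N = j and m' = "pfst (Suc j)" and n' = "psnd (Suc j)"]])
         (auto simp: S_def 0 pfst_def psnd_def fun_eq_iff)
  qed (auto simp: S_def fun_eq_iff 0)
  have 2: "exec (moveC (k+1) k) (S ?N) (R(k := pfst ?N, k+2 := psnd ?N))"
    by (rule exec_eq[OF exec_moveC]) (use 0 in \<open>auto simp: fun_eq_iff S_def\<close>)
  have 3: "exec (moveC (k+2) (k+1)) (R(k := pfst ?N, k+2 := psnd ?N)) (R(k := pfst ?N, k+1 := psnd ?N))"
    by (rule exec_eq[OF exec_moveC]) (use 0 in \<open>auto simp: fun_eq_iff\<close>)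
  show ?thesis unfolding decC_def using exec_SEQ[OF 1 exec_SEQ[OF 2 3]] .
qed

text \<open>The argument is in register \<open>k\<close> and the registers above it are scratch space. As \<open>k\<close> is
  arbitrary, programs can be run above registers that hold live values.\<close>
definition wcomp :: "(nat \<Rightarrow> nat) \<Rightarrow> bool" where
  "wcomp f \<longleftrightarrow> (\<forall>k. \<exists>c. \<forall>R. (\<forall>r>k. R r = 0) \<longrightarrow> exec c R (R(k := f (R k))))"

lemma wcompI:
  assumes "\<And>k. \<exists>c. \<forall>R. (\<forall>r>k. R r = 0) \<longrightarrow> exec c R (R(k := f (R k)))"
  shows "wcomp f"
  using assms unfolding wcomp_def by blast

lemma wcompE:
  assumes "wcomp f"
  obtains c where "\<And>R. (\<And>r. r > k \<Longrightarrow> R r = 0) \<Longrightarrow> exec c R (R(k := f (R k)))"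
  using assms unfolding wcomp_def by meson

lemma wcomp_id: "wcomp (\<lambda>n. n)"
  by (intro wcompI exI[of _ SKIP]) (auto intro: exec_eq[OF exec_SKIP])

lemma wcomp_Suc0: "wcomp Suc"
proof (rule wcompI)
  fix k show "\<exists>c. \<forall>R. (\<forall>r>k. R r = 0) \<longrightarrow> exec c R (R(k := Suc (R k)))"
    by (intro exI[of _ "INCR k"]) (auto intro: exec_INCR)
qed

lemma wcomp_zero: "wcomp (\<lambda>n. 0)"
proof (rule wcompI)
  fix k show "\<exists>c. \<forall>R. (\<forall>r>k. R r = 0) \<longrightarrow> exec c R (R(k := 0))"
    by (intro exI[of _ "clearC k"]) (auto intro: exec_clearC)
qed

lemma wcomp_comp: 
  assumes "wcomp f" "wcomp g" shows "wcomp (\<lambda>n. f (g n))"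
proof (rule wcompI)
  fix k
  obtain c where c: "\<And>R. (\<And>r. r > k \<Longrightarrow> R r = 0) \<Longrightarrow> exec c R (R(k := f (R k)))"
    using wcompE[OF assms(1)] by blast
  obtain d where d: "\<And>R. (\<And>r. r > k \<Longrightarrow> R r = 0) \<Longrightarrow> exec d R (R(k := g (R k)))"
    using wcompE[OF assms(2)] by blast
  have "exec (SEQ d c) R (R(k := f (g (R k))))" if "\<forall>r>k. R r = 0" for R
    using that by (intro exec_SEQ[OF d exec_eq[OF c]]) (auto simp: fun_eq_iff)
  then show "\<exists>c. \<forall>R. (\<forall>r>k. R r = 0) \<longrightarrow> exec c R (R(k := f (g (R k))))" by blast
qed

lemma wcomp_pfst0: "wcomp pfst"
proof (rule wcompI)
  fix k
  have "exec (SEQ (decC k) (clearC (k+1))) R (R(k := pfst (R k)))" if "\<forall>r>k. R r = 0" for R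
    using that by (intro exec_SEQ[OF exec_decC exec_eq[OF exec_clearC]]) (auto simp: fun_eq_iff)
  then show "\<exists>c. \<forall>R. (\<forall>r>k. R r = 0) \<longrightarrow> exec c R (R(k := pfst (R k)))" by blast
qed

lemma wcomp_psnd0: "wcomp psnd"
proof (rule wcompI)
  fix k
  have "exec (SEQ (decC k) (SEQ (clearC k) (moveC (k+1) k))) R (R(k := psnd (R k)))" if "\<forall>r>k. R r = 0" for R
    using that by (intro exec_SEQ[OF exec_decC exec_SEQ[OF exec_clearC exec_eq[OF exec_moveC]]])
      (auto simp: fun_eq_iff)
  then show "\<exists>c. \<forall>R. (\<forall>r>k. R r = 0) \<longrightarrow> exec c R (R(k := psnd (R k)))" by blast
qed

text \<open>A program needs zeros above its argument, so a saved copy must lie below it. The first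
  function runs in \<open>k+1\<close> with the argument kept in \<open>k\<close>; the two registers
  are exchanged through \<open>k+2\<close> before the second function runs.\<close>

lemma wcomp_pair: 
  assumes "wcomp f" "wcomp g" shows "wcomp (\<lambda>n. pair (f n) (g n))"
proof (rule wcompI)
  fix k
  obtain c where c: "\<And>R. (\<And>r. r > k+1 \<Longrightarrow> R r = 0) \<Longrightarrow> exec c R (R(k+1 := f (R (k+1))))"
    using wcompE[OF assms(1)] by blast
  obtain d where d: "\<And>R. (\<And>r. r > k+1 \<Longrightarrow> R r = 0) \<Longrightarrow> exec d R (R(k+1 := g (R (k+1))))"
    using wcompE[OF assms(2)] by blast
  let ?c = "SEQ (copyC k (k+1) (k+2)) (SEQ c (SEQ (moveC k (k+2)) (SEQ (moveC (k+1) k)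
     (SEQ (moveC (k+2) (k+1)) (SEQ d (encC k))))))"
  have "exec ?c R (R(k := pair (f (R k)) (g (R k))))" if 0: "\<forall>r>k. R r = 0" for R
  proof -
    have 1: "exec (copyC k (k+1) (k+2)) R (R(k+1 := R k))"
      by (rule exec_eq[OF exec_copyC]) (use 0 in \<open>auto simp: fun_eq_iff\<close>)
    have 2: "exec c (R(k+1 := R k)) (R(k+1 := f (R k)))"
      by (rule exec_eq[OF c]) (use 0 in \<open>auto simp: fun_eq_iff\<close>)
    have 3: "exec (moveC k (k+2)) (R(k+1 := f (R k))) (R(k := 0, k+1 := f (R k), k+2 := R k))"
      by (rule exec_eq[OF exec_moveC]) (use 0 in \<open>auto simp: fun_eq_iff\<close>)
    have 4: "exec (moveC (k+1) k) (R(k := 0, k+1 := f (R k), k+2 := R k)) (R(k := f (R k), k+2 := R k))"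
      by (rule exec_eq[OF exec_moveC]) (use 0 in \<open>auto simp: fun_eq_iff\<close>)
    have 5: "exec (moveC (k+2) (k+1)) (R(k := f (R k), k+2 := R k)) (R(k := f (R k), k+1 := R k))"
      by (rule exec_eq[OF exec_moveC]) (use 0 in \<open>auto simp: fun_eq_iff\<close>)
    have 6: "exec d (R(k := f (R k), k+1 := R k)) (R(k := f (R k), k+1 := g (R k)))"
      by (rule exec_eq[OF d]) (use 0 in \<open>auto simp: fun_eq_iff\<close>)
    have 7: "exec (encC k) (R(k := f (R k), k+1 := g (R k))) (R(k := pair (f (R k)) (g (R k))))"
      by (rule exec_eq[OF exec_encC]) (use 0 in \<open>auto simp: fun_eq_iff pair_def\<close>)
    show ?thesis
      using exec_SEQ[OF 1 exec_SEQ[OF 2 exec_SEQ[OF 3 exec_SEQ[OF 4 exec_SEQ[OF 5 exec_SEQ[OF 6 7]]]]]] .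
  qed
  then show "\<exists>c. \<forall>R. (\<forall>r>k. R r = 0) \<longrightarrow> exec c R (R(k := pair (f (R k)) (g (R k))))" by blast
qed

text \<open>Together with pairing, bounded iteration gives primitive recursion, and all later
  arithmetic is built from it.\<close>

lemma wcomp_iterate0: 
  assumes "wcomp f" shows "wcomp (\<lambda>n. (f ^^ pfst n) (psnd n))"
proof (rule wcompI)
  fix k
  obtain c where c: "\<And>R. (\<And>r. r > k+1 \<Longrightarrow> R r = 0) \<Longrightarrow> exec c R (R(k+1 := f (R (k+1))))"
    using wcompE[OF assms(1)] by blast
  let ?c = "SEQ (decC k) (SEQ (LOOP k c) (moveC (k+1) k))"
  have "exec ?c R (R(k := (f ^^ pfst (R k)) (psnd (R k))))" if 0: "\<forall>r>k. R r = 0" for R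
  proof -
    let ?N = "pfst (R k)"
    have 1: "exec (decC k) R (R(k := ?N, k+1 := psnd (R k)))"
      by (rule exec_decC) (use 0 in auto)
    have 2: "exec (LOOP k c) (R(k := ?N, k+1 := psnd (R k))) (R(k := 0, k+1 := (f ^^ ?N) (psnd (R k))))"
      by (rule exec_for[where S = "\<lambda>j. R(k := ?N - j, k+1 := (f ^^ j) (psnd (R k)))" and N = ?N])
         (use 0 in \<open>auto intro!: exec_eq[OF c] simp: fun_eq_iff\<close>)
    have 3: "exec (moveC (k+1) k) (R(k := 0, k+1 := (f ^^ ?N) (psnd (R k)))) (R(k := (f ^^ ?N) (psnd (R k))))"
      by (rule exec_eq[OF exec_moveC]) (use 0 in \<open>auto simp: fun_eq_iff\<close>)
    show ?thesis using exec_SEQ[OF 1 exec_SEQ[OF 2 3]] .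
  qed
  then show "\<exists>c. \<forall>R. (\<forall>r>k. R r = 0) \<longrightarrow> exec c R (R(k := (f ^^ pfst (R k)) (psnd (R k))))" by blast
qed

text \<open>The only program with an unbounded loop. Register 0 holds the input, 1 the current
  candidate and 2 the last value of \<open>g\<close>. That the machine runs forever when there is no
  zero is argued on the machine itself.\<close>

lemma re_set_search:
  assumes "wcomp g"
  shows "re_set {n. \<exists>t. g (pair n t) = 0}"
proof -
  obtain c where c: "\<And>R. (\<And>r. r > 2 \<Longrightarrow> R r = 0) \<Longrightarrow> exec c R (R(2 := g (R 2)))"
    using wcompE[OF assms(1)] by blast
  define body where "body = SEQ (clearC 2) (SEQ (copyC 0 2 4) (SEQ (copyC 1 3 4) (SEQ (encC 2)
     (SEQ c (INCR 1)))))"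
  define p where "p = compile 0 (SEQ (INCR 2) (LOOP 2 body))"
  \<comment> \<open>The initial 1 in register 2 makes the loop run before any value of
    \<open>g\<close> has been computed.\<close>
  define S where "S = (\<lambda>n j (r::nat). if r = 0 then n else if r = 1 then j else if r = 2 then
      (if j = 0 then 1 else g (pair n (j - 1))) else 0 :: nat)"
  have body: "exec body ((S n j)(2 := S n j 2 - 1)) (S n (Suc j))" for n j
  proof -
    let ?R = "\<lambda>x y r::nat. if r = 0 then n else if r = 1 then j else if r = 2 then x else if r = 3 then y else 0 :: nat"
    have 1: "exec (clearC 2) ((S n j)(2 := S n j 2 - 1)) (?R 0 0)"
      by (rule exec_eq[OF exec_clearC]) (auto simp: fun_eq_iff S_def)
    have 2: "exec (copyC 0 2 4) (?R 0 0) (?R n 0)"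
      by (rule exec_eq[OF exec_copyC]) (auto simp: fun_eq_iff)
    have 3: "exec (copyC 1 3 4) (?R n 0) (?R n j)"
      by (rule exec_eq[OF exec_copyC]) (auto simp: fun_eq_iff)
    have 4: "exec (encC 2) (?R n j) (?R (pair n j) 0)"
      by (rule exec_eq[OF exec_encC]) (auto simp: fun_eq_iff pair_def)
    have 5: "exec c (?R (pair n j) 0) (?R (g (pair n j)) 0)"
      by (rule exec_eq[OF c]) (auto simp: fun_eq_iff)
    have 6: "exec (INCR 1) (?R (g (pair n j)) 0) (S n (Suc j))"
      by (rule exec_eq[OF exec_INCR]) (auto simp: fun_eq_iff S_def)
    show ?thesis unfolding body_def
      using exec_SEQ[OF 1 exec_SEQ[OF 2 exec_SEQ[OF 3 exec_SEQ[OF 4 exec_SEQ[OF 5 6]]]]] .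
  qed
  have start: "exec (INCR 2) ((\<lambda>_. 0)(0 := n)) (S n 0)" for n
    by (rule exec_eq[OF exec_INCR]) (auto simp: fun_eq_iff S_def)
  have code_p: "code_at p 0 p" by (rule code_at_self)
  have code_loop: "code_at p 1 (compile 1 (LOOP 2 body))"
    using code_at_append[of p 0 "compile 0 (INCR 2)" "compile 1 (LOOP 2 body)"] code_p
    unfolding p_def by simp
  have code_body: "code_at p 2 (compile 2 body)"
    using code_at_LOOP[OF code_loop] by (simp add: numeral_2_eq_2)
  have start': "(mstep p ^^ 1) (init_config n) = (1, S n 0)" for n
    using code_at_Cons[of p 0 "Inc 2 1"] code_p start[of n]
    by (auto simp: mstep_def p_def init_config_def fun_eq_iff S_def)
  have "halts_on p n \<longleftrightarrow> (\<exists>t. g (pair n t) = 0)" for n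
  proof
    assume "\<exists>t. g (pair n t) = 0"
    then obtain t where t: "g (pair n t) = 0" "\<And>i. i < t \<Longrightarrow> g (pair n i) \<noteq> 0"
      using exists_least_iff[of "\<lambda>t. g (pair n t) = 0"] by auto
    have "exec (LOOP 2 body) (S n 0) (S n (Suc t))"
      by (rule exec_LOOP_iterate) (use t body in \<open>auto simp: S_def\<close>)
    from exec_SEQ[OF start this] have "exec (SEQ (INCR 2) (LOOP 2 body)) ((\<lambda>_. 0)(0 := n)) (S n (Suc t))" .
    from compile_correct[OF this, of p 0] code_p
    obtain T where "(mstep p ^^ T) (0, (\<lambda>_. 0)(0 := n)) = (clen (SEQ (INCR 2) (LOOP 2 body)), S n (Suc t))"
      by (auto simp: p_def)
    then have "length p \<le> fst ((mstep p ^^ T) (init_config n))"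
      by (simp add: init_config_def p_def)
    then show "halts_on p n" unfolding halts_on_def by blast
  next
    assume "halts_on p n"
    then obtain T where T: "length p \<le> fst ((mstep p ^^ T) (init_config n))"
      unfolding halts_on_def by blast
    show "\<exists>t. g (pair n t) = 0"
    proof (rule ccontr)
      assume neg: "\<not> ?thesis"
      \<comment> \<open>The \<open>j\<close>-th visit to the loop head happens at time
        \<open>j\<close> or later. For \<open>j = T\<close> the machine is still inside the program
        at a time when it should have halted for good.\<close>
      have "\<exists>t\<ge>j. (mstep p ^^ t) (init_config n) = (1, S n j)" for j
      proof (induction j)
        case 0
        show ?case using start' by blast
      next
        case (Suc j)
        then obtain t where t: "t \<ge> j" "(mstep p ^^ t) (init_config n) = (1, S n j)" by blast
        have "\<exists>t. (mstep p ^^ t) (1 + 1, (S n j)(2 := S n j 2 - 1)) = (1 + 1 + clen body, S n (Suc j))"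
          using compile_correct[OF body, of p 2 n j] code_body by (simp add: numeral_2_eq_2)
        moreover have "0 < S n j 2" using neg by (auto simp: S_def)
        ultimately obtain t' where t': "t' \<ge> 1" "(mstep p ^^ t') (1, S n j) = (1, S n (Suc j))"
          using mstep_LOOP_pass[OF code_loop] by blast
        show ?case using mstep_trans[OF t(2) t'(2)] t(1) t'(1) by (intro exI[of _ "t' + t"]) auto
      qed
      then obtain t where "t \<ge> T" "(mstep p ^^ t) (init_config n) = (1, S n T)" by blast
      with halted_stable[OF T] have "length p \<le> 1" by fastforce
      then show False by (simp add: p_def)
    qed
  qed
  then show ?thesis unfolding re_set_def by blast
qed

section \<open>Closure properties of computable functions\<close>

named_theorems wcomp_intros

lemmas [wcomp_intros] = wcomp_id wcomp_pair

lemma wcomp_Suc [wcomp_intros]: "wcomp f \<Longrightarrow> wcomp (\<lambda>n. Suc (f n))"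
  by (rule wcomp_comp[OF wcomp_Suc0])

lemma wcomp_pfst [wcomp_intros]: "wcomp f \<Longrightarrow> wcomp (\<lambda>n. pfst (f n))"
  by (rule wcomp_comp[OF wcomp_pfst0])

lemma wcomp_psnd [wcomp_intros]: "wcomp f \<Longrightarrow> wcomp (\<lambda>n. psnd (f n))"
  by (rule wcomp_comp[OF wcomp_psnd0])

lemma wcomp_const [wcomp_intros]: "wcomp (\<lambda>n. c)"
  by (induction c) (auto intro: wcomp_zero wcomp_Suc)

lemma wcomp_comp2:
  assumes "wcomp (\<lambda>z. h (pfst z) (psnd z))" "wcomp f" "wcomp g"
  shows "wcomp (\<lambda>n. h (f n) (g n))"
  using wcomp_comp[OF assms(1) wcomp_pair[OF assms(2,3)]] by simp

text \<open>The parameter \<open>n\<close> travels in the state, since \<open>wcomp_iterate0\<close>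
  iterates one fixed function of one argument.\<close>

lemma wcomp_iterate [wcomp_intros]:
  assumes "wcomp (\<lambda>z. F (pfst z) (psnd z))" "wcomp c" "wcomp a"
  shows "wcomp (\<lambda>n. (F n ^^ c n) (a n))"
proof -
  define G where "G z = pair (pfst z) (F (pfst z) (psnd z))" for z
  have G: "(G ^^ j) (pair n x) = pair n ((F n ^^ j) x)" for j n x
    by (induction j) (auto simp: G_def)
  have "wcomp G" unfolding G_def[abs_def] by (intro wcomp_intros assms)
  from wcomp_comp[OF wcomp_iterate0[OF this] wcomp_pair[OF assms(2) wcomp_pair[OF wcomp_id assms(3)]]]
  have "wcomp (\<lambda>n. pair n ((F n ^^ c n) (a n)))"
    by (simp add: G)
  from wcomp_psnd[OF this] show ?thesis by simp
qed

lemma wcomp_add [wcomp_intros]: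
  assumes "wcomp f" "wcomp g" shows "wcomp (\<lambda>n. f n + g n)"
proof -
  have "(Suc ^^ a) b = a + b" for a b by (induction a) auto
  moreover have "wcomp (\<lambda>n. (Suc ^^ f n) (g n))" by (intro wcomp_intros assms)
  ultimately show ?thesis by simp
qed

lemma wcomp_mult [wcomp_intros]:
  assumes "wcomp f" "wcomp g" shows "wcomp (\<lambda>n. f n * g n)"
proof -
  have "((\<lambda>x. x + b) ^^ a) 0 = a * b" for a b :: nat by (induction a) auto
  moreover have "wcomp (\<lambda>n. ((\<lambda>x. x + g n) ^^ f n) 0)"
    by (intro wcomp_intros wcomp_comp[OF assms(2)] assms)
  ultimately show ?thesis by simp
qed

lemma wcomp_power [wcomp_intros]:
  assumes "wcomp f" "wcomp g" shows "wcomp (\<lambda>n. f n ^ g n)"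
proof -
  have "((\<lambda>x. x * b) ^^ a) 1 = b ^ a" for a b :: nat by (induction a) auto
  moreover have "wcomp (\<lambda>n. ((\<lambda>x. x * f n) ^^ g n) 1)"
    by (intro wcomp_intros wcomp_comp[OF assms(1)] assms)
  ultimately show ?thesis by simp
qed

lemma wcomp_pred:
  assumes "wcomp f" shows "wcomp (\<lambda>n. f n - 1)"
proof -
  \<comment> \<open>Kleene's predecessor: the second component trails the counter by one.\<close>
  have "((\<lambda>z. pair (Suc (pfst z)) (pfst z)) ^^ a) (pair 0 0) = pair a (a - 1)" for a
    by (induction a) auto
  moreover have "wcomp (\<lambda>n. psnd (((\<lambda>z. pair (Suc (pfst z)) (pfst z)) ^^ f n) (pair 0 0)))"
    by (intro wcomp_intros assms)
  ultimately show ?thesis by simp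
qed

lemma wcomp_diff [wcomp_intros]:
  assumes "wcomp f" "wcomp g" shows "wcomp (\<lambda>n. f n - g n)"
proof -
  have "((\<lambda>x. x - 1) ^^ a) b = b - a" for a b :: nat by (induction a) auto
  moreover have "wcomp (\<lambda>n. ((\<lambda>x. x - 1) ^^ g n) (f n))"
    by (intro wcomp_intros wcomp_pred assms)
  ultimately show ?thesis by simp
qed

section \<open>Decidable predicates and finite tables\<close>

definition wdec :: "(nat \<Rightarrow> bool) \<Rightarrow> bool" where
  "wdec P \<longleftrightarrow> wcomp (\<lambda>n. if P n then 1 else 0)"

lemma wdecI: "wcomp f \<Longrightarrow> (\<And>n. P n \<longleftrightarrow> f n = 0) \<Longrightarrow> wdec P"
  unfolding wdec_def
  by (rule back_subst[of wcomp, OF wcomp_diff[OF wcomp_const[of 1], of f]]) (auto simp: fun_eq_iff)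

lemma wcomp_If [wcomp_intros]:
  assumes "wdec P" "wcomp f" "wcomp g"
  shows "wcomp (\<lambda>n. if P n then f n else g n)"
proof -
  have "wcomp (\<lambda>n. (if P n then 1 else 0) * f n + (1 - (if P n then 1 else 0)) * g n)"
    using assms unfolding wdec_def by (intro wcomp_intros)
  then show ?thesis by (rule back_subst[of wcomp]) (auto simp: fun_eq_iff)
qed

lemma wdec_le [wcomp_intros]: "wcomp f \<Longrightarrow> wcomp g \<Longrightarrow> wdec (\<lambda>n. f n \<le> g n)"
  by (rule wdecI[OF wcomp_diff[of f g]]) auto

lemma wdec_not [wcomp_intros]: "wdec P \<Longrightarrow> wdec (\<lambda>n. \<not> P n)"
  by (rule wdecI[of "\<lambda>n. if P n then 1 else 0"]) (auto simp: wdec_def)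

lemma wdec_const [wcomp_intros]: "wdec (\<lambda>n. b)"
  unfolding wdec_def by (rule wcomp_const)

lemma wdec_conj [wcomp_intros]: "wdec P \<Longrightarrow> wdec Q \<Longrightarrow> wdec (\<lambda>n. P n \<and> Q n)"
  unfolding wdec_def
  by (drule (1) wcomp_mult, erule back_subst[of wcomp]) (auto simp: fun_eq_iff)

lemma wdec_less [wcomp_intros]: "wcomp f \<Longrightarrow> wcomp g \<Longrightarrow> wdec (\<lambda>n. f n < g n)"
  unfolding not_le[symmetric] by (intro wdec_not wdec_le)

lemma wdec_eq [wcomp_intros]: "wcomp f \<Longrightarrow> wcomp g \<Longrightarrow> wdec (\<lambda>n. f n = g n)"
  unfolding eq_iff by (intro wdec_conj wdec_le)

lemma wdec_comp: "wdec P \<Longrightarrow> wcomp f \<Longrightarrow> wdec (\<lambda>n. P (f n))"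
  unfolding wdec_def by (rule wcomp_comp)

lemma wdec_comp2: "wdec (\<lambda>z. P (pfst z) (psnd z)) \<Longrightarrow> wcomp f \<Longrightarrow> wcomp g \<Longrightarrow> wdec (\<lambda>n. P (f n) (g n))"
  unfolding wdec_def by (rule wcomp_comp2[where h = "\<lambda>x y. if P x y then 1 else 0"])

lemma wdec_bex [wcomp_intros]:
  assumes "wdec (\<lambda>z. P (pfst z) (psnd z))" "wcomp b"
  shows "wdec (\<lambda>n. \<exists>i<b n. P n i)"
proof -
  define F where "F n x = pair (Suc (pfst x)) (if P n (pfst x) then 1 else psnd x)" for n x
  have F: "(F n ^^ j) (pair 0 0) = pair j (if \<exists>i<j. P n i then 1 else 0)" for n j
    by (induction j) (auto simp: F_def less_Suc_eq)
  have "wcomp (\<lambda>n. psnd ((F n ^^ b n) (pair 0 0)))"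
    unfolding F_def by (intro wcomp_intros assms wdec_comp2[OF assms(1)])
  then show ?thesis by (simp add: F wdec_def)
qed

lemma wdec_ball [wcomp_intros]:
  assumes "wdec (\<lambda>z. P (pfst z) (psnd z))" "wcomp b"
  shows "wdec (\<lambda>n. \<forall>i<b n. P n i)"
  by (rule back_subst[of wdec, OF wdec_not[OF wdec_bex[OF wdec_not[OF assms(1)] assms(2)]]]) auto

text \<open>The bound is a constant of the program, so \<open>P i\<close> need not be uniform in
  \<open>i\<close>, in contrast to \<open>wdec_ball\<close>: every conjunct is programmed
  separately.\<close>

lemma wdec_All_less:
  "(\<And>i. i < (m::nat) \<Longrightarrow> wdec (\<lambda>n. P i n)) \<Longrightarrow> wdec (\<lambda>n. \<forall>i<m. P i n)"
proof (induction m)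
  case (Suc m)
  then have "wdec (\<lambda>n. P m n \<and> (\<forall>i<m. P i n))" by (intro wdec_conj) auto
  then show ?case by (rule back_subst[of wdec]) (auto simp: fun_eq_iff less_Suc_eq)
qed (simp add: wdec_const)

lemma wcomp_div_mod:
  assumes "wcomp f" "wcomp g"
  shows "wcomp (\<lambda>n. f n div g n)" "wcomp (\<lambda>n. f n mod g n)"
proof -
  \<comment> \<open>For \<open>d = 0\<close> the test never succeeds, which gives quotient 0 and
    remainder \<open>x\<close>, in agreement with HOL's division by zero.\<close>
  define F where "F d x = (if Suc (psnd x) = d then pair (Suc (pfst x)) 0 else pair (pfst x) (Suc (psnd x)))"
    for d x
  have F: "(F d ^^ x) (pair 0 0) = pair (x div d) (x mod d)" for d x
    by (induction x) (auto simp: F_def div_Suc mod_Suc)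
  have "wcomp (\<lambda>n. (F (g n) ^^ f n) (pair 0 0))"
    unfolding F_def by (intro wcomp_intros assms wcomp_comp[OF assms(2)])
  from wcomp_pfst[OF this] wcomp_psnd[OF this]
  show "wcomp (\<lambda>n. f n div g n)" "wcomp (\<lambda>n. f n mod g n)" by (simp_all add: F)
qed

lemmas [wcomp_intros] = wcomp_div_mod

text \<open>The functions \<open>H i\<close> are hard-coded one by one without uniformity in
  \<open>i\<close>. This is how transitions and polynomial coefficients become part of a
  program.\<close>

lemma wcomp_table:
  assumes "\<And>i. i < D \<Longrightarrow> wcomp (H i)" "wcomp g"
  shows "wcomp (\<lambda>n. if g n < D then H (g n) n else 0)"
  using assms(1)
proof (induction D)
  case (Suc D)
  have "wcomp (\<lambda>n. if g n = D then H D n else if g n < D then H (g n) n else 0)"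
    by (intro wcomp_intros assms Suc) auto
  then show ?case by (rule back_subst[of wcomp]) (auto simp: fun_eq_iff)
qed (simp add: wcomp_const)

text \<open>Integers appear as differences of naturals that are not normalised, so that sums and
  products avoid case distinctions on signs and equality becomes an equality of naturals.\<close>

definition icomp :: "(nat \<Rightarrow> int) \<Rightarrow> bool" where
  "icomp f \<longleftrightarrow> (\<exists>g. wcomp g \<and> (\<forall>n. f n = int (pfst (g n)) - int (psnd (g n))))"

lemma icompI: "wcomp a \<Longrightarrow> wcomp b \<Longrightarrow> (\<And>n. f n = int (a n) - int (b n)) \<Longrightarrow> icomp f"
  unfolding icomp_def by (intro exI[of _ "\<lambda>n. pair (a n) (b n)"]) (auto intro: wcomp_pair)

lemma icompE:
  assumes "icomp f"
  obtains a b where "wcomp a" "wcomp b" "\<And>n. f n = int (a n) - int (b n)"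
  using assms unfolding icomp_def by (metis wcomp_pfst wcomp_psnd)

lemma icomp_int: "wcomp f \<Longrightarrow> icomp (\<lambda>n. int (f n))"
  by (rule icompI[of f "\<lambda>_. 0"]) (auto intro: wcomp_const)

lemma icomp_const: "icomp (\<lambda>n. c)"
  by (rule icompI[of "\<lambda>_. nat c" "\<lambda>_. nat (- c)"]) (auto intro: wcomp_const)

lemma icomp_add:
  assumes "icomp f" "icomp g" shows "icomp (\<lambda>n. f n + g n)"
proof -
  obtain a b where f: "wcomp a" "wcomp b" "\<And>n. f n = int (a n) - int (b n)" using icompE[OF assms(1)] by blast
  obtain c d where g: "wcomp c" "wcomp d" "\<And>n. g n = int (c n) - int (d n)" using icompE[OF assms(2)] by blast
  show ?thesis
    by (rule icompI[of "\<lambda>n. a n + c n" "\<lambda>n. b n + d n"]) (auto intro: wcomp_intros f g simp: f g)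
qed

lemma icomp_mult:
  assumes "icomp f" "icomp g" shows "icomp (\<lambda>n. f n * g n)"
proof -
  obtain a b where f: "wcomp a" "wcomp b" "\<And>n. f n = int (a n) - int (b n)" using icompE[OF assms(1)] by blast
  obtain c d where g: "wcomp c" "wcomp d" "\<And>n. g n = int (c n) - int (d n)" using icompE[OF assms(2)] by blast
  show ?thesis
    by (rule icompI[of "\<lambda>n. a n * c n + b n * d n" "\<lambda>n. a n * d n + b n * c n"])
       (auto intro!: wcomp_intros f g simp: f g algebra_simps)
qed

lemma icomp_sum: "(\<And>i. i < (m::nat) \<Longrightarrow> icomp (f i)) \<Longrightarrow> icomp (\<lambda>n. \<Sum>i<m. f i n)"
  by (induction m) (auto intro: icomp_const icomp_add)

lemma icomp_comp: "icomp f \<Longrightarrow> wcomp g \<Longrightarrow> icomp (\<lambda>n. f (g n))"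
  by (erule icompE, rule icompI) (auto intro: wcomp_comp)

lemma icomp_comp2: "icomp (\<lambda>z. h (pfst z) (psnd z)) \<Longrightarrow> wcomp f \<Longrightarrow> wcomp g \<Longrightarrow> icomp (\<lambda>n. h (f n) (g n))"
  using icomp_comp[OF _ wcomp_pair, of "\<lambda>z. h (pfst z) (psnd z)" f g] by simp

lemma icomp_power:
  assumes "icomp f" "wcomp g" shows "icomp (\<lambda>n. f n ^ g n)"
proof -
  obtain a b where f: "wcomp a" "wcomp b" "\<And>n. f n = int (a n) - int (b n)" using icompE[OF assms(1)] by blast
  define F where "F n z = pair (pfst z * a n + psnd z * b n) (pfst z * b n + psnd z * a n)" for n z
  have F: "int (pfst ((F n ^^ j) (pair 1 0))) - int (psnd ((F n ^^ j) (pair 1 0))) = f n ^ j" for n j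
    by (induction j) (auto simp: F_def f algebra_simps)
  have "wcomp (\<lambda>n. (F n ^^ g n) (pair 1 0))"
    unfolding F_def by (intro wcomp_intros assms wcomp_comp[OF f(1)] wcomp_comp[OF f(2)])
  then show ?thesis unfolding icomp_def using F by (intro exI conjI) auto
qed

lemma wdec_int_eq:
  assumes "icomp f" "icomp g" shows "wdec (\<lambda>n. f n = g n)"
proof -
  obtain a b where f: "wcomp a" "wcomp b" "\<And>n. f n = int (a n) - int (b n)" using icompE[OF assms(1)] by blast
  obtain c d where g: "wcomp c" "wcomp d" "\<And>n. g n = int (c n) - int (d n)" using icompE[OF assms(2)] by blast
  have "wdec (\<lambda>n. a n + d n = c n + b n)" by (intro wcomp_intros f g)
  then show ?thesis by (rule back_subst[of wdec]) (auto simp: fun_eq_iff f g)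
qed

lemma icomp_table:
  assumes "\<And>i. i < D \<Longrightarrow> icomp (H i)" "wcomp g"
  shows "icomp (\<lambda>n. if g n < D then H (g n) n else 0)"
proof -
  have "\<forall>i\<in>{..<D}. \<exists>a. wcomp a \<and> (\<forall>n. H i n = int (pfst (a n)) - int (psnd (a n)))"
    using assms(1) unfolding icomp_def by blast
  then obtain a where a: "\<And>i. i < D \<Longrightarrow> wcomp (a i)"
     "\<And>i n. i < D \<Longrightarrow> H i n = int (pfst (a i n)) - int (psnd (a i n))"
    unfolding bchoice_iff by auto
  have "wcomp (\<lambda>n. if g n < D then a (g n) n else 0)"
    by (intro wcomp_table assms a)
  then show ?thesis unfolding icomp_def
    by (intro exI conjI) (auto simp: a)
qed

text \<open>A number codes the infinite stream of its iterated projections. Both projections of 0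
  are 0, so the tail 0 is the zero stream: infinitely many registers, almost all of them empty, fit
  into one number.\<close>

definition sget :: "nat \<Rightarrow> nat \<Rightarrow> nat" where
  "sget s r = pfst ((psnd ^^ r) s)"

lemma sget_0 [simp]: "sget s 0 = pfst s"
  and sget_Suc [simp]: "sget s (Suc r) = sget (psnd s) r"
  by (simp_all add: sget_def funpow_swap1)

lemma wcomp_sget [wcomp_intros]: "wcomp f \<Longrightarrow> wcomp g \<Longrightarrow> wcomp (\<lambda>n. sget (f n) (g n))"
  unfolding sget_def by (intro wcomp_intros)

primrec supd :: "nat \<Rightarrow> nat \<Rightarrow> nat \<Rightarrow> nat" where
  "supd s 0 v = pair v (psnd s)"
| "supd s (Suc r) v = pair (pfst s) (supd (psnd s) r v)"

lemma sget_supd [simp]: "sget (supd s r v) r' = (if r' = r then v else sget s r')"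
proof (induction r arbitrary: s r')
  case 0
  show ?case by (cases r') auto
next
  case (Suc r)
  then show ?case by (cases r') auto
qed

text \<open>The recursion of \<^const>\<open>supd\<close> is turned into two loops that move the prefix of the stream
  to a stack and back.\<close>
lemma wcomp_supd [wcomp_intros]:
  assumes "wcomp f" "wcomp g" "wcomp h"
  shows "wcomp (\<lambda>n. supd (f n) (g n) (h n))"
proof -
  define fwd where "fwd z = pair (pair (pfst (psnd z)) (pfst z)) (psnd (psnd z))" for z
  define bwd where "bwd z = pair (psnd (pfst z)) (pair (pfst (pfst z)) (psnd z))" for z
  define put where "put v z = pair (pfst z) (pair v (psnd (psnd z)))" for v z
  have *: "(bwd ^^ r) (put v ((fwd ^^ r) (pair a s))) = pair a (supd s r v)" for r a s v
  proof (induction r arbitrary: a s)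
    case 0
    show ?case by (simp add: put_def)
  next
    case (Suc r)
    have "(fwd ^^ Suc r) (pair a s) = (fwd ^^ r) (pair (pair (pfst s) a) (psnd s))"
      by (simp add: funpow_Suc_right fwd_def del: funpow.simps)
    then show ?case using Suc by (simp add: bwd_def)
  qed
  have "wcomp (\<lambda>n. psnd ((bwd ^^ g n) (put (h n) ((fwd ^^ g n) (pair 0 (f n))))))"
    unfolding bwd_def fwd_def put_def by (intro wcomp_intros assms)
  then show ?thesis by (simp add: *)
qed

primrec tup :: "nat \<Rightarrow> (nat \<Rightarrow> nat) \<Rightarrow> nat" where
  "tup 0 f = 0"
| "tup (Suc m) f = pair (f 0) (tup m (\<lambda>i. f (Suc i)))"

lemma sget_tup: "i < m \<Longrightarrow> sget (tup m f) i = f i"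
proof (induction m arbitrary: f i)
  case (Suc m)
  then show ?case by (cases i) auto
qed simp

lemma wcomp_tup: "(\<And>i. i < m \<Longrightarrow> wcomp (f i)) \<Longrightarrow> wcomp (\<lambda>n. tup m (\<lambda>i. f i n))"
  by (induction m arbitrary: f) (auto intro!: wcomp_intros)

text \<open>Meant for rows of products of integer matrices, where the dimension \<open>m\<close> is
  fixed and the number of factors varies. The iterated state holds the step number, on which the
  coefficients depend, and a stream of \<open>m\<close> pairs coding integers.\<close>

lemma icomp_linear_recurrence:
  fixes x :: "nat \<Rightarrow> nat \<Rightarrow> nat \<Rightarrow> int" and c :: "nat \<Rightarrow> nat \<Rightarrow> nat \<Rightarrow> nat \<Rightarrow> int"
  assumes c: "\<And>k l. k < m \<Longrightarrow> l < m \<Longrightarrow> icomp (\<lambda>z. c k l (pfst z) (psnd z))"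
    and x0: "\<And>n l. l < m \<Longrightarrow> x n 0 l = v l"
    and xS: "\<And>n j l. l < m \<Longrightarrow> x n (Suc j) l = (\<Sum>k<m. x n j k * c k l n j)"
    and N: "wcomp N" and l: "l < m"
  shows "icomp (\<lambda>n. x n (N n) l)"
proof -
  define dec where "dec s = int (pfst s) - int (psnd s)" for s
  define y where "y s l = dec (sget (psnd s) l)" for s l
  have "icomp (\<lambda>z. y (psnd z) k)" for k
    unfolding y_def dec_def
    by (rule icompI[of "\<lambda>z. pfst (sget (psnd (psnd z)) k)" "\<lambda>z. psnd (sget (psnd (psnd z)) k)"])
       (auto intro!: wcomp_intros)
  moreover have "icomp (\<lambda>z. c k l (pfst z) (pfst (psnd z)))" if "k < m" "l < m" for k l
    by (rule icomp_comp2[OF c[OF that]]) (intro wcomp_intros)+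
  ultimately have "icomp (\<lambda>z. \<Sum>k<m. y (psnd z) k * c k l (pfst z) (pfst (psnd z)))" if "l < m" for l
    using that by (intro icomp_sum icomp_mult) auto
  then have "\<forall>l\<in>{..<m}. \<exists>g. wcomp g \<and> (\<forall>z. (\<Sum>k<m. y (psnd z) k * c k l (pfst z) (pfst (psnd z))) = dec (g z))"
    unfolding icomp_def dec_def by blast
  then obtain g where g: "\<And>l. l < m \<Longrightarrow> wcomp (g l)"
    "\<And>l z. l < m \<Longrightarrow> (\<Sum>k<m. y (psnd z) k * c k l (pfst z) (pfst (psnd z))) = dec (g l z)"
    unfolding bchoice_iff by auto
  define F where "F n s = pair (Suc (pfst s)) (tup m (\<lambda>l. g l (pair n s)))" for n s
  have F_fst: "pfst (F n s) = Suc (pfst s)" for n s by (simp add: F_def)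
  define s0 where "s0 = pair 0 (tup m (\<lambda>l. pair (nat (v l)) (nat (- v l))))"
  have *: "pfst ((F n ^^ j) s0) = j \<and> (\<forall>l<m. y ((F n ^^ j) s0) l = x n j l)" for n j
  proof (induction j)
    case 0
    then show ?case by (auto simp: s0_def y_def sget_tup dec_def x0)
  next
    case (Suc j)
    have "y (F n ((F n ^^ j) s0)) l = x n (Suc j) l" if "l < m" for l
    proof -
      have "y (F n ((F n ^^ j) s0)) l = dec (g l (pair n ((F n ^^ j) s0)))"
        using that by (simp add: F_def y_def sget_tup)
      also have "\<dots> = x n (Suc j) l"
        using that Suc by (simp add: g(2)[symmetric] xS)
      finally show ?thesis .
    qed
    moreover have "pfst (F n ((F n ^^ j) s0)) = Suc j" using Suc by (simp add: F_fst)
    ultimately show ?case by simp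
  qed
  have "wcomp (\<lambda>z. F (pfst z) (psnd z))"
    unfolding F_def by (intro wcomp_intros wcomp_tup wcomp_comp[OF g(1)])
  then have "wcomp (\<lambda>n. sget (psnd ((F n ^^ N n) s0)) l)"
    by (intro wcomp_intros N)
  moreover have "x n (N n) l = dec (sget (psnd ((F n ^^ N n) s0)) l)" for n
    using * l by (simp add: y_def)
  ultimately show ?thesis unfolding icomp_def dec_def by blast
qed

section \<open>An undecidable recursively enumerable language\<close>

lemma re_set_Ex:
  assumes "wdec (\<lambda>z. P (pfst z) (psnd z))"
  shows "re_set {n. \<exists>t. P n t}"
proof -
  have "wcomp (\<lambda>z. if P (pfst z) (psnd z) then 0 else 1)"
    by (intro wcomp_If assms wcomp_const)
  from re_set_search[OF this] show ?thesis
    by (rule back_subst[of re_set]) auto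
qed

lemma re_set_wdec: "wdec P \<Longrightarrow> re_set {n. P n}"
  using re_set_Ex[of "\<lambda>n t. P n"] wdec_comp[OF _ wcomp_pfst0] by simp

section \<open>A universal counter machine and the halting problem\<close>

definition instr_of :: "nat \<Rightarrow> instr" where
  "instr_of x = (if pfst x = 0 then Inc (pfst (psnd x)) (psnd (psnd x))
     else Dec (pfst (psnd x)) (pfst (psnd (psnd x))) (psnd (psnd (psnd x))))"

definition prog_of :: "nat \<Rightarrow> instr list" where
  "prog_of e = map (\<lambda>i. instr_of (sget (psnd e) i)) [0..<pfst e]"

lemma instr_of_surj: "\<exists>x. instr_of x = i"
proof (cases i)
  case (Inc r j)
  then show ?thesis by (intro exI[of _ "pair 0 (pair r j)"]) (simp add: instr_of_def)
next
  case (Dec r j k)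
  then show ?thesis by (intro exI[of _ "pair 1 (pair r (pair j k))"]) (simp add: instr_of_def)
qed

lemma prog_of_surj: "\<exists>e. prog_of e = p"
proof -
  obtain enc where enc: "\<And>i. instr_of (enc i) = i" using instr_of_surj by metis
  have "prog_of (pair (length p) (tup (length p) (\<lambda>i. enc (p ! i)))) = p"
    by (rule nth_equalityI) (auto simp: prog_of_def sget_tup enc)
  then show ?thesis by blast
qed

text \<open>A step of \<open>prog_of e\<close> on coded configurations, spelled out with projections
  so that the closure rules apply to it as it stands, uniformly in \<open>e\<close>.\<close>

definition ustep :: "nat \<Rightarrow> nat \<Rightarrow> nat" where
  "ustep e c = (if pfst c < pfst e then
     (if pfst (sget (psnd e) (pfst c)) = 0 then
        pair (psnd (psnd (sget (psnd e) (pfst c))))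
          (supd (psnd c) (pfst (psnd (sget (psnd e) (pfst c))))
             (Suc (sget (psnd c) (pfst (psnd (sget (psnd e) (pfst c)))))))
      else if 0 < sget (psnd c) (pfst (psnd (sget (psnd e) (pfst c)))) then
        pair (pfst (psnd (psnd (sget (psnd e) (pfst c)))))
          (supd (psnd c) (pfst (psnd (sget (psnd e) (pfst c))))
             (sget (psnd c) (pfst (psnd (sget (psnd e) (pfst c)))) - 1))
      else pair (psnd (psnd (psnd (sget (psnd e) (pfst c))))) (psnd c))
   else c)"

definition config_of :: "nat \<Rightarrow> config" where
  "config_of c = (pfst c, sget (psnd c))"

lemma config_of_ustep: "config_of (ustep e c) = mstep (prog_of e) (config_of c)"
  by (auto simp: config_of_def ustep_def mstep_def prog_of_def instr_of_def fun_eq_iff)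

lemma config_of_init: "config_of (pair 0 (pair n 0)) = init_config n"
proof -
  have "sget 0 r = 0" for r by (induction r) auto
  then have "sget (pair n 0) r = ((\<lambda>_. 0)(0 := n)) r" for r by (cases r) auto
  then show ?thesis by (auto simp: config_of_def init_config_def)
qed

lemma halts_on_prog_of:
  "halts_on (prog_of e) n \<longleftrightarrow> (\<exists>t. pfst e \<le> pfst ((ustep e ^^ t) (pair 0 (pair n 0))))"
proof -
  have "config_of ((ustep e ^^ t) c) = (mstep (prog_of e) ^^ t) (config_of c)" for t c
    by (induction t) (auto simp: config_of_ustep)
  note * = this[of _ "pair 0 (pair n 0)", unfolded config_of_init, symmetric]
  show ?thesis unfolding halts_on_def * by (simp add: config_of_def prog_of_def)
qed

lemma wdec_halts_within:
  "wdec (\<lambda>z. pfst (pfst z) \<le> pfst ((ustep (pfst z) ^^ psnd z) (pair 0 (pair (pfst z) 0))))"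
  unfolding ustep_def by (intro wcomp_intros)

definition halting_set :: "nat set" where
  "halting_set = {n. halts_on (prog_of n) n}"

text \<open>Diagonalisation: a machine that halts exactly outside the halting set has a code
  \<open>e\<close>, and it contradicts itself on input \<open>e\<close>.\<close>

lemma halting_set_undecidable: "\<not> wdec (\<lambda>n. n \<in> halting_set)"
proof
  assume "wdec (\<lambda>n. n \<in> halting_set)"
  from re_set_wdec[OF wdec_not[OF this]] obtain p where
    p: "\<And>n. n \<notin> halting_set \<longleftrightarrow> halts_on p n"
    unfolding re_set_def by auto
  obtain e where "prog_of e = p" using prog_of_surj by blast
  with p[of e] show False by (simp add: halting_set_def)
qed

lemma inj_list_encode: "inj list_encode"
  by (metis injI list_encode_inverse)

lemma wcomp_list_encode_replicate: "wcomp (\<lambda>n. list_encode (replicate n a))"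
proof -
  have "((\<lambda>x. Suc (pair a x)) ^^ n) 0 = list_encode (replicate n a)" for n
    by (induction n) (auto simp: pair_def)
  moreover have "wcomp (\<lambda>n. ((\<lambda>x. Suc (pair a x)) ^^ n) 0)" by (intro wcomp_intros)
  ultimately show ?thesis by simp
qed

definition halting_lang :: "nat list set" where
  "halting_lang = (\<lambda>n. replicate n 0) ` halting_set"

lemma halting_lang_RE: "({0}, halting_lang) \<in> RE_class"
proof -
  let ?H = "\<lambda>n t. pfst n \<le> pfst ((ustep n ^^ t) (pair 0 (pair n 0)))"
  \<comment> \<open>The witness \<open>t\<close> pairs the word length with a number of steps, so
    that a single unbounded search covers both.\<close>
  have "list_encode ` halting_lang =
     {m. \<exists>t. m = list_encode (replicate (pfst t) 0) \<and> ?H (pfst t) (psnd t)}"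
    unfolding halting_lang_def halting_set_def halts_on_prog_of
    by (auto simp: image_iff) (metis pfst_pair psnd_pair)
  moreover have "wdec (\<lambda>z. pfst z = list_encode (replicate (pfst (psnd z)) 0) \<and>
      ?H (pfst (psnd z)) (psnd (psnd z)))"
    by (intro wcomp_intros wcomp_comp[OF wcomp_list_encode_replicate] wdec_comp[OF wdec_halts_within])
  ultimately have "re_set (list_encode ` halting_lang)"
    using re_set_Ex[of "\<lambda>m t. m = list_encode (replicate (pfst t) 0) \<and> ?H (pfst t) (psnd t)"] by simp
  moreover have "halting_lang \<subseteq> lists {0}" by (auto simp: halting_lang_def)
  ultimately show ?thesis by (simp add: RE_class_def)
qed

lemma halting_lang_undecidable: "\<not> wdec (\<lambda>m. m \<in> list_encode ` halting_lang)"
proof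
  assume "wdec (\<lambda>m. m \<in> list_encode ` halting_lang)"
  from wdec_comp[OF this wcomp_list_encode_replicate[of 0]]
  have "wdec (\<lambda>n. replicate n 0 \<in> halting_lang)"
    by (simp add: inj_image_mem_iff[OF inj_list_encode])
  moreover have "replicate n 0 \<in> halting_lang \<longleftrightarrow> n \<in> halting_set" for n
    unfolding halting_lang_def by (metis (no_types, lifting) image_iff length_replicate)
  ultimately show False using halting_set_undecidable by simp
qed

section \<open>Integer polynomials and the word problem of matrices\<close>

text \<open>Polynomial functions with integer coefficients in the variables below \<open>r\<close>,
  with \<open>D\<close> an upper bound on the total degree. Working with functions makes evaluation
  mere application; over an infinite field a function that vanishes everywhere is the zero
  polynomial.\<close>

inductive zpoly :: "nat \<Rightarrow> nat \<Rightarrow> ((nat \<Rightarrow> complex) \<Rightarrow> complex) \<Rightarrow> bool" for r where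
  zpoly_const: "zpoly r D (\<lambda>_. of_int c)"
| zpoly_var: "i < r \<Longrightarrow> zpoly r (Suc D) (\<lambda>x. x i)"
| zpoly_add: "zpoly r D f \<Longrightarrow> zpoly r D g \<Longrightarrow> zpoly r D (\<lambda>x. f x + g x)"
| zpoly_mult: "zpoly r D f \<Longrightarrow> zpoly r E g \<Longrightarrow> zpoly r (D + E) (\<lambda>x. f x * g x)"

lemma zpoly_mono: "zpoly r D f \<Longrightarrow> D \<le> E \<Longrightarrow> zpoly r E f"
proof (induction arbitrary: E rule: zpoly.induct)
  case (zpoly_var i D)
  then show ?case using zpoly.zpoly_var[of i r "E - 1"] by simp
next
  case (zpoly_mult D f D' g)
  have "zpoly r (E - D' + D') (\<lambda>x. f x * g x)"
    using zpoly_mult by (intro zpoly.zpoly_mult) auto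
  then show ?case using zpoly_mult.prems by simp
qed (auto intro: zpoly.intros)

lemma zpoly_0: "zpoly r D (\<lambda>_. 0)" and zpoly_1: "zpoly r D (\<lambda>_. 1)"
  using zpoly_const[of r D 0] zpoly_const[of r D 1] by auto

lemma zpoly_uminus: "zpoly r D f \<Longrightarrow> zpoly r D (\<lambda>x. - f x)"
  using zpoly_mult[OF zpoly_const[of r 0 "- 1"], of D f] by simp

lemma zpoly_diff: "zpoly r D f \<Longrightarrow> zpoly r D g \<Longrightarrow> zpoly r D (\<lambda>x. f x - g x)"
  using zpoly_add[OF _ zpoly_uminus, of r D f g] by simp

lemma zpoly_sum: "(\<And>i. i \<in> I \<Longrightarrow> zpoly r D (f i)) \<Longrightarrow> zpoly r D (\<lambda>x. \<Sum>i\<in>I. f i x)"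
  by (induction I rule: infinite_finite_induct) (auto intro: zpoly_0 zpoly_add)

lemma zpoly_power: "zpoly r D f \<Longrightarrow> zpoly r (D * n) (\<lambda>x. f x ^ n)"
  by (induction n) (auto intro: zpoly_1 zpoly_mult)

lemma zpoly_cong: "zpoly r D f \<Longrightarrow> (\<And>i. i < r \<Longrightarrow> x i = y i) \<Longrightarrow> f x = f y"
  by (induction rule: zpoly.induct) auto

lemma zpoly_univariate:
  "zpoly r D f \<Longrightarrow> \<exists>p. degree p \<le> D \<and> (\<forall>z. f (x(i := z)) = poly p z)"
proof (induction rule: zpoly.induct)
  case (zpoly_const D c)
  show ?case by (intro exI[of _ "[:of_int c:]"]) auto
next
  case (zpoly_var j D)
  show ?case by (intro exI[of _ "if j = i then [:0, 1:] else [:x j:]"]) auto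
next
  case (zpoly_add D f g)
  then obtain p q where "degree p \<le> D" "degree q \<le> D" "\<forall>z. f (x(i := z)) = poly p z"
    "\<forall>z. g (x(i := z)) = poly q z" by blast
  then show ?case by (intro exI[of _ "p + q"]) (auto intro: degree_add_le simp: fun_upd_def)
next
  case (zpoly_mult D f E g)
  then obtain p q where "degree p \<le> D" "degree q \<le> E" "\<forall>z. f (x(i := z)) = poly p z"
    "\<forall>z. g (x(i := z)) = poly q z" by blast
  then show ?case
    by (intro exI[of _ "p * q"]) (auto intro: order_trans[OF degree_mult_le add_mono] simp: fun_upd_def)
qed

text \<open>A univariate polynomial of degree at most \<open>D\<close> with the \<open>D + 1\<close>
  roots \<open>0, ..., D\<close> is zero. Applied to one coordinate after another, this extends
  vanishing from the grid to the whole space.\<close>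

lemma zpoly_grid:
  assumes f: "zpoly r D f"
    and grid: "\<And>s. (\<And>i. i < r \<Longrightarrow> s i \<le> D) \<Longrightarrow> f (\<lambda>i. of_nat (s i)) = 0"
  shows "f x = 0"
proof -
  \<comment> \<open>The coordinates below \<open>j\<close> are already free, the remaining ones
    still lie on the grid.\<close>
  have "(\<And>i. j \<le> i \<Longrightarrow> i < r \<Longrightarrow> \<exists>s\<le>D. x i = of_nat s) \<Longrightarrow> f x = 0" for j x
  proof (induction j arbitrary: x)
    case 0
    then have "\<forall>i\<in>{..<r}. \<exists>s\<le>D. x i = of_nat s" by auto
    then obtain s where s: "\<And>i. i < r \<Longrightarrow> s i \<le> D \<and> x i = of_nat (s i)"
      unfolding bchoice_iff by auto
    then have "f x = f (\<lambda>i. of_nat (s i))" by (intro zpoly_cong[OF f]) auto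
    with grid s show ?case by simp
  next
    case (Suc j)
    obtain p where p: "degree p \<le> D" "\<And>z. f (x(j := z)) = poly p z"
      using zpoly_univariate[OF f] by blast
    have "poly p (of_nat s) = 0" if "s \<le> D" for s
      unfolding p(2)[symmetric]
      by (rule Suc.IH) (use that Suc.prems in \<open>auto simp: Suc_le_eq\<close>)
    then have roots: "of_nat ` {..D} \<subseteq> {z. poly p z = 0}" by auto
    have "p = 0"
    proof (rule ccontr)
      assume "p \<noteq> 0"
      then have "card (of_nat ` {..D} :: complex set) \<le> degree p"
        using card_mono[OF poly_roots_finite roots] card_poly_roots_bound[of p] by fastforce
      moreover have "card (of_nat ` {..D} :: complex set) = Suc D"
        by (subst card_image) (auto simp: inj_on_def)
      ultimately show False using p(1) by simp
    qed
    with p(2)[of "x j"] show ?case by simp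
  qed
  from this[of r x] show ?thesis by simp
qed

section \<open>Grid points as digits of a number\<close>

definition digit :: "nat \<Rightarrow> nat \<Rightarrow> nat \<Rightarrow> nat" where
  "digit N x i = x div N ^ i mod N"

lemma digit_less: "0 < N \<Longrightarrow> digit N x i < N"
  by (simp add: digit_def)

lemma digit_0: "s < N \<Longrightarrow> digit N (s + N * x) 0 = s"
  and digit_Suc: "s < N \<Longrightarrow> digit N (s + N * x) (Suc i) = digit N x i"
  by (simp_all add: digit_def div_mult2_eq)

lemma digits_exist:
  "(\<And>i. i < r \<Longrightarrow> s i < N) \<Longrightarrow> \<exists>x<N ^ r. \<forall>i<r. digit N x i = s i"
proof (induction r arbitrary: s)
  case 0
  show ?case by (intro exI[of _ 0]) simp
next
  case (Suc r)
  obtain x where x: "x < N ^ r" "\<forall>i<r. digit N x i = s (Suc i)"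
    using Suc.IH[of "\<lambda>i. s (Suc i)"] Suc.prems by auto
  have s0: "s 0 < N" using Suc.prems by simp
  have "s 0 + N * x < N + N * x" using s0 by simp
  also have "\<dots> = N * Suc x" by simp
  also have "\<dots> \<le> N * N ^ r" by (rule mult_le_mono) (use x(1) in auto)
  finally have "s 0 + N * x < N ^ Suc r" by simp
  moreover have "digit N (s 0 + N * x) i = s i" if "i < Suc r" for i
    using that x(2) s0 by (cases i) (auto simp: digit_0 digit_Suc)
  ultimately show ?case by blast
qed

text \<open>Numbers below \<open>Suc D ^ r\<close> enumerate the grid, which makes the test one
  bounded quantifier over naturals.\<close>

lemma zpoly_grid_digits:
  assumes f: "zpoly r D f"
    and grid: "\<And>y. y < Suc D ^ r \<Longrightarrow> f (\<lambda>i. of_nat (digit (Suc D) y i)) = 0"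
  shows "f x = 0"
proof (rule zpoly_grid[OF f])
  fix s :: "nat \<Rightarrow> nat" assume "\<And>i. i < r \<Longrightarrow> s i \<le> D"
  then obtain y where "y < Suc D ^ r" "\<forall>i<r. digit (Suc D) y i = s i"
    using digits_exist[of r s "Suc D"] by (auto simp: less_Suc_eq_le)
  with grid zpoly_cong[OF f, of "\<lambda>i. of_nat (digit (Suc D) y i)" "\<lambda>i. of_nat (s i)"]
  show "f (\<lambda>i. of_nat (s i)) = 0" by simp
qed

text \<open>Read as a polynomial in the last variable, a relation among \<open>r + 1\<close> numbers
  becomes an equation for the last one over the ring generated by the others.\<close>

lemma zpoly_last_variable:
  "zpoly (Suc r) D f \<Longrightarrow>
    \<exists>P. (\<forall>k. \<exists>E. zpoly r E (\<lambda>x. coeff (P x) k)) \<and> (\<forall>x. f x = poly (P x) (x r))"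
proof (induction rule: zpoly.induct)
  case (zpoly_const D c)
  show ?case
  proof (intro exI[of _ "\<lambda>_. [:of_int c:]"] conjI allI)
    fix k show "\<exists>E. zpoly r E (\<lambda>x. coeff [:of_int c:] k)"
      by (cases k) (auto intro: zpoly_0 zpoly.zpoly_const)
  qed simp
next
  case (zpoly_var i D)
  show ?case
  proof (cases "i = r")
    case True
    show ?thesis
    proof (intro exI[of _ "\<lambda>_. [:0, 1:]"] conjI allI)
      fix k show "\<exists>E. zpoly r E (\<lambda>x. coeff [:0, 1:] k)"
        using zpoly_0 zpoly_1 by (auto simp: coeff_pCons split: nat.splits)
    qed (simp add: True)
  next
    case False
    show ?thesis
    proof (intro exI[of _ "\<lambda>x. [:x i:]"] conjI allI)
      fix k show "\<exists>E. zpoly r E (\<lambda>x. coeff [:x i:] k)"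
        using zpoly.zpoly_var[of i r 0] zpoly_0 False zpoly_var by (cases k) (auto simp: less_Suc_eq)
    qed simp
  qed
next
  case (zpoly_add D f g)
  then obtain P Q where P: "\<And>k. \<exists>E. zpoly r E (\<lambda>x. coeff (P x) k)" "\<And>x. f x = poly (P x) (x r)"
     and Q: "\<And>k. \<exists>E. zpoly r E (\<lambda>x. coeff (Q x) k)" "\<And>x. g x = poly (Q x) (x r)" by metis
  show ?case
  proof (intro exI[of _ "\<lambda>x. P x + Q x"] conjI allI)
    fix k
    obtain E1 E2 where "zpoly r E1 (\<lambda>x. coeff (P x) k)" "zpoly r E2 (\<lambda>x. coeff (Q x) k)"
      using P Q by blast
    then have "zpoly r (max E1 E2) (\<lambda>x. coeff (P x) k + coeff (Q x) k)"
      by (intro zpoly.zpoly_add) (auto elim: zpoly_mono)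
    then show "\<exists>E. zpoly r E (\<lambda>x. coeff (P x + Q x) k)" by auto
  qed (simp add: P Q)
next
  case (zpoly_mult D f D' g)
  then obtain P Q where P: "\<And>k. \<exists>E. zpoly r E (\<lambda>x. coeff (P x) k)" "\<And>x. f x = poly (P x) (x r)"
     and Q: "\<And>k. \<exists>E. zpoly r E (\<lambda>x. coeff (Q x) k)" "\<And>x. g x = poly (Q x) (x r)" by metis
  obtain E1 where E1: "\<And>k. zpoly r (E1 k) (\<lambda>x. coeff (P x) k)" using P(1) by metis
  obtain E2 where E2: "\<And>k. zpoly r (E2 k) (\<lambda>x. coeff (Q x) k)" using Q(1) by metis
  show ?case
  proof (intro exI[of _ "\<lambda>x. P x * Q x"] conjI allI)
    fix k
    have "zpoly r (\<Sum>i\<le>k. E1 i + E2 (k - i)) (\<lambda>x. \<Sum>i\<le>k. coeff (P x) i * coeff (Q x) (k - i))"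
    proof (rule zpoly_sum)
      fix i assume "i \<in> {..k}"
      then have "E1 i + E2 (k - i) \<le> (\<Sum>i\<le>k. E1 i + E2 (k - i))"
        by (intro member_le_sum) auto
      with zpoly.zpoly_mult[OF E1 E2]
      show "zpoly r (\<Sum>i\<le>k. E1 i + E2 (k - i)) (\<lambda>x. coeff (P x) i * coeff (Q x) (k - i))"
        by (rule zpoly_mono)
    qed
    then show "\<exists>E. zpoly r E (\<lambda>x. coeff (P x * Q x) k)" by (auto simp: coeff_mult)
  qed (simp add: P Q)
qed

section \<open>Transcendence bases\<close>

definition alg_indep :: "nat \<Rightarrow> (nat \<Rightarrow> complex) \<Rightarrow> bool" where
  "alg_indep r t \<longleftrightarrow> (\<forall>D f. zpoly r D f \<longrightarrow> f t = 0 \<longrightarrow> (\<forall>x. f x = 0))"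

text \<open>This bounds the length of an independent family inside a finite set, so a longest one
  exists.\<close>

lemma alg_indep_inj:
  assumes "alg_indep r t" shows "inj_on t {..<r}"
proof (rule inj_onI, rule ccontr)
  fix i j assume ij: "i \<in> {..<r}" "j \<in> {..<r}" "t i = t j" "i \<noteq> j"
  then have "zpoly r 1 (\<lambda>x. x i - x j)"
    using zpoly_diff zpoly_var[of _ r 0] by simp
  with assms ij(3) have "\<forall>x::nat \<Rightarrow> complex. x i - x j = 0"
    unfolding alg_indep_def by (metis (mono_tags, lifting) diff_self)
  from spec[OF this, of "\<lambda>k. if k = i then 1 else 0"] ij(4) show False by simp
qed

definition zring :: "nat \<Rightarrow> (nat \<Rightarrow> complex) \<Rightarrow> complex set" where
  "zring r t = {f t | f D. zpoly r D f}"

text \<open>For a ring \<open>R\<close> this is algebraicity over its fraction field, denominators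
  being cleared.\<close>

definition algebraic_over :: "complex set \<Rightarrow> complex \<Rightarrow> bool" where
  "algebraic_over R a \<longleftrightarrow> (\<exists>p. p \<noteq> 0 \<and> (\<forall>k. coeff p k \<in> R) \<and> poly p a = 0)"

text \<open>Appending \<open>a\<close> to a longest independent family gives a dependent one, hence
  a relation \<open>f\<close> that is not identically zero. Expanded in its last variable, it is an
  equation for \<open>a\<close>. This equation is nontrivial: if all its coefficients vanished at
  \<open>t\<close>, independence would make them vanish everywhere, and \<open>f\<close> with
  them.\<close>

lemma transcendence_basis:
  assumes "finite E"
  obtains r t where "alg_indep r t" "\<And>a. a \<in> E \<Longrightarrow> algebraic_over (zring r t) a"
proof -
  let ?P = "\<lambda>r. \<exists>t. alg_indep r t \<and> t ` {..<r} \<subseteq> E"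
  have "alg_indep 0 t" for t
    unfolding alg_indep_def using zpoly_cong[of 0] by (metis less_nat_zero_code)
  then have "?P 0" by auto
  moreover have "r \<le> card E" if "?P r" for r
    using that alg_indep_inj card_inj_on_le[OF _ _ assms] by fastforce
  ultimately obtain r where r: "?P r" "\<And>r'. ?P r' \<Longrightarrow> r' \<le> r"
    using ex_has_greatest_nat[of ?P 0 id "Suc (card E)"] by (auto simp: less_Suc_eq_le)
  then obtain t where t: "alg_indep r t" "t ` {..<r} \<subseteq> E" by blast
  have "algebraic_over (zring r t) a" if a: "a \<in> E" for a
  proof -
    let ?t = "t(r := a)"
    have "?t ` {..<Suc r} \<subseteq> E" using t(2) a by (auto simp: less_Suc_eq)
    then have "?P (Suc r)" if "alg_indep (Suc r) ?t" using that by blast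
    then have "\<not> alg_indep (Suc r) ?t" using r(2)[of "Suc r"] by (metis Suc_n_not_le_n)
    then obtain D f x where f: "zpoly (Suc r) D f" "f ?t = 0" "f x \<noteq> 0"
      unfolding alg_indep_def by blast
    obtain P where P: "\<And>k. \<exists>E. zpoly r E (\<lambda>x. coeff (P x) k)" "\<And>x. f x = poly (P x) (x r)"
      using zpoly_last_variable[OF f(1)] by blast
    have "coeff (P ?t) k = coeff (P t) k" for k
      using P(1)[of k] zpoly_cong[of r _ "\<lambda>x. coeff (P x) k" ?t t] by auto
    then have "P ?t = P t" by (rule poly_eqI)
    then have "poly (P t) a = 0" using f(2) P(2)[of ?t] by simp
    moreover have "P t \<noteq> 0"
    proof
      assume 0: "P t = 0"
      have "coeff (P x) k = 0" for k
      proof -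
        obtain E where "zpoly r E (\<lambda>x. coeff (P x) k)" using P(1) by blast
        with t(1) 0 show ?thesis unfolding alg_indep_def by (metis coeff_0)
      qed
      then have "P x = 0" by (intro poly_eqI) auto
      with P(2)[of x] f(3) show False by simp
    qed
    moreover have "coeff (P t) k \<in> zring r t" for k
      using P(1)[of k] unfolding zring_def by auto
    ultimately show ?thesis unfolding algebraic_over_def by blast
  qed
  with t(1) that show thesis by blast
qed

section \<open>Linear algebra over the fraction field of a ring of complex numbers\<close>

locale coeff_ring =
  fixes R :: "complex set"
  assumes R_1: "1 \<in> R"
    and R_add: "x \<in> R \<Longrightarrow> y \<in> R \<Longrightarrow> x + y \<in> R"
    and R_mult: "x \<in> R \<Longrightarrow> y \<in> R \<Longrightarrow> x * y \<in> R"
    and R_uminus: "x \<in> R \<Longrightarrow> - x \<in> R"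
begin

lemma R_0: "0 \<in> R"
  using R_add[OF R_1 R_uminus[OF R_1]] by simp

text \<open>The span over the fraction field of \<open>R\<close>; clearing denominators avoids forming that field.\<close>
definition sp :: "complex set \<Rightarrow> complex set" where
  "sp S = {x. \<exists>d\<in>R. d \<noteq> 0 \<and> (\<exists>c. (\<forall>s\<in>S. c s \<in> R) \<and> d * x = (\<Sum>s\<in>S. c s * s))}"

lemma spI: "d \<in> R \<Longrightarrow> d \<noteq> 0 \<Longrightarrow> (\<And>s. s \<in> S \<Longrightarrow> c s \<in> R) \<Longrightarrow> d * x = (\<Sum>s\<in>S. c s * s) \<Longrightarrow> x \<in> sp S"
  unfolding sp_def by blast

lemma spE:
  assumes "x \<in> sp S"
  obtains d c where "d \<in> R" "d \<noteq> 0" "\<And>s. s \<in> S \<Longrightarrow> c s \<in> R" "d * x = (\<Sum>s\<in>S. c s * s)"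
  using assms unfolding sp_def by blast

lemma sp_add:
  assumes "x \<in> sp S" "y \<in> sp S" shows "x + y \<in> sp S"
proof -
  obtain d c where x: "d \<in> R" "d \<noteq> 0" "\<And>s. s \<in> S \<Longrightarrow> c s \<in> R" "d * x = (\<Sum>s\<in>S. c s * s)"
    using spE[OF assms(1)] by blast
  obtain e b where y: "e \<in> R" "e \<noteq> 0" "\<And>s. s \<in> S \<Longrightarrow> b s \<in> R" "e * y = (\<Sum>s\<in>S. b s * s)"
    using spE[OF assms(2)] by blast
  have "d * e * (x + y) = e * (d * x) + d * (e * y)" by (simp add: algebra_simps)
  also have "\<dots> = (\<Sum>s\<in>S. (e * c s + d * b s) * s)"
    unfolding x(4) y(4) by (simp add: sum_distrib_left sum.distrib algebra_simps)
  finally show ?thesis using x y by (intro spI[of "d * e" S "\<lambda>s. e * c s + d * b s"]) (auto intro: R_mult R_add)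
qed

lemma sp_scale:
  assumes "a \<in> R" "x \<in> sp S" shows "a * x \<in> sp S"
proof -
  obtain d c where x: "d \<in> R" "d \<noteq> 0" "\<And>s. s \<in> S \<Longrightarrow> c s \<in> R" "d * x = (\<Sum>s\<in>S. c s * s)"
    using spE[OF assms(2)] by blast
  have "d * (a * x) = a * (d * x)" by simp
  also have "\<dots> = (\<Sum>s\<in>S. (a * c s) * s)" unfolding x(4) by (simp add: sum_distrib_left mult.assoc)
  finally show ?thesis using x assms by (intro spI[of d S "\<lambda>s. a * c s"]) (auto intro: R_mult)
qed

lemma sp_cancel:
  assumes "a \<in> R" "a \<noteq> 0" "a * x \<in> sp S" shows "x \<in> sp S"
proof -
  obtain d c where x: "d \<in> R" "d \<noteq> 0" "\<And>s. s \<in> S \<Longrightarrow> c s \<in> R" "d * (a * x) = (\<Sum>s\<in>S. c s * s)"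
    using spE[OF assms(3)] by blast
  then show ?thesis using assms by (intro spI[of "d * a" S c]) (auto intro: R_mult simp: mult.assoc)
qed

lemma sp_0: "0 \<in> sp S"
  by (rule spI[of 1 S "\<lambda>_. 0"]) (auto intro: R_1 R_0)

lemma sp_base:
  assumes "finite S" "s \<in> S" shows "s \<in> sp S"
  by (rule spI[of 1 S "\<lambda>x. if x = s then 1 else 0"]) (use assms in \<open>auto intro: R_1 R_0 simp: if_distrib if_distribR sum.delta cong: if_cong\<close>)

lemma sp_sum: "(\<And>i. i \<in> I \<Longrightarrow> f i \<in> sp S) \<Longrightarrow> (\<Sum>i\<in>I. f i) \<in> sp S"
  by (induction I rule: infinite_finite_induct) (auto intro: sp_0 sp_add)

text \<open>The case \<open>y = 1\<close> is transitivity of the span; a general \<open>y\<close>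
  shows that multiplication maps one span into another as soon as it does so on generators.\<close>

lemma sp_trans:
  assumes "\<And>s. s \<in> S \<Longrightarrow> s * y \<in> sp T" "x \<in> sp S"
  shows "x * y \<in> sp T"
proof -
  obtain d c where x: "d \<in> R" "d \<noteq> 0" "\<And>s. s \<in> S \<Longrightarrow> c s \<in> R" "d * x = (\<Sum>s\<in>S. c s * s)"
    using spE[OF assms(2)] by blast
  have "d * (x * y) = (\<Sum>s\<in>S. c s * (s * y))"
    using x(4) by (simp add: mult.assoc[symmetric] sum_distrib_right)
  also have "\<dots> \<in> sp T" by (intro sp_sum sp_scale x assms)
  finally show ?thesis using sp_cancel x by blast
qed

text \<open>The elements are adjoined one at a time, as in a tower of finite extensions: the
  generators are multiplied by the powers \<open>a ^ e\<close> below the degree \<open>d\<close> of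
  an equation for \<open>a\<close>, and this equation reduces \<open>a ^ d\<close> to lower powers.
  The leading coefficient is cancelled, so the equation need not be monic.\<close>

lemma sp_mult_closed:
  assumes "finite E" "\<And>a. a \<in> E \<Longrightarrow> algebraic_over R a"
  shows "\<exists>S. finite S \<and> 1 \<in> S \<and> (\<forall>a\<in>E. \<forall>s\<in>S. a * s \<in> sp S)"
  using assms
proof (induction E rule: finite_induct)
  case empty
  show ?case by (intro exI[of _ "{1}"]) auto
next
  case (insert a E)
  then obtain S where S: "finite S" "1 \<in> S" "\<And>a s. a \<in> E \<Longrightarrow> s \<in> S \<Longrightarrow> a * s \<in> sp S" by blast
  obtain p where p: "p \<noteq> 0" "\<And>k. coeff p k \<in> R" "poly p a = 0"
    using insert.prems unfolding algebraic_over_def by blast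
  define d where "d = degree p"
  have "d \<noteq> 0"
  proof
    assume "d = 0"
    then obtain c where "p = [:c:]" using degree_eq_zeroE unfolding d_def by blast
    with p show False by auto
  qed
  define S' where "S' = (\<lambda>(s, e). s * a ^ e) ` (S \<times> {..<d})"
  have fin: "finite S'" using S(1) by (auto simp: S'_def)
  have base: "s * a ^ e \<in> sp S'" if "s \<in> S" "e < d" for s e
    by (rule sp_base[OF fin]) (use that in \<open>force simp: S'_def\<close>)
  have top: "s * a ^ d \<in> sp S'" if "s \<in> S" for s
  proof (rule sp_cancel)
    show "coeff p d \<in> R" "coeff p d \<noteq> 0" using p by (auto simp: d_def)
    have "0 = (\<Sum>k\<le>d. coeff p k * a ^ k)" using p(3) by (simp add: poly_altdef d_def)
    also have "\<dots> = (\<Sum>k<d. coeff p k * a ^ k) + coeff p d * a ^ d"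
      by (simp add: lessThan_Suc_atMost[symmetric])
    finally have "coeff p d * a ^ d = - (\<Sum>k<d. coeff p k * a ^ k)"
      by (simp add: eq_neg_iff_add_eq_0 add.commute)
    then have "coeff p d * (s * a ^ d) = s * - (\<Sum>k<d. coeff p k * a ^ k)"
      by (metis mult.left_commute)
    also have "\<dots> = (\<Sum>k<d. (- coeff p k) * (s * a ^ k))"
      by (simp add: sum_distrib_left sum_negf mult.left_commute)
    also have "\<dots> \<in> sp S'"
      using that by (intro sp_sum sp_scale R_uminus p base) auto
    finally show "coeff p d * (s * a ^ d) \<in> sp S'" .
  qed
  have "b * x \<in> sp S'" if bx: "b \<in> insert a E" "x \<in> S'" for b x
  proof -
    obtain s e where x: "x = s * a ^ e" "s \<in> S" "e < d" using bx(2) by (auto simp: S'_def)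
    show ?thesis
    proof (cases "b = a")
      case True
      have "s * a ^ Suc e \<in> sp S'"
        using x base[of s "Suc e"] top[of s] by (cases "Suc e = d") auto
      then show ?thesis by (simp add: x True mult.left_commute)
    next
      case False
      then have "b * s \<in> sp S" using bx S(3) x by auto
      \<comment> \<open>Multiplication by \<open>b\<close> stays in the old span, and
        \<open>a ^ e\<close> sends its generators into the new one.\<close>
      then have "(b * s) * a ^ e \<in> sp S'" by (rule sp_trans[rotated]) (rule base, use x in auto)
      then show ?thesis by (simp add: x mult.assoc)
    qed
  qed
  moreover have "1 \<in> S'" using S(2) \<open>d \<noteq> 0\<close> by (force simp: S'_def)
  ultimately show ?case using fin by blast
qed

definition lin_indep :: "complex set \<Rightarrow> bool" where
  "lin_indep B \<longleftrightarrow> (\<forall>c. (\<forall>b\<in>B. c b \<in> R) \<longrightarrow> (\<Sum>b\<in>B. c b * b) = 0 \<longrightarrow> (\<forall>b\<in>B. c b = 0))"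

lemma lin_indepD:
  "lin_indep B \<Longrightarrow> (\<And>b. b \<in> B \<Longrightarrow> c b \<in> R) \<Longrightarrow> (\<Sum>b\<in>B. c b * b) = 0 \<Longrightarrow> b \<in> B \<Longrightarrow> c b = 0"
  unfolding lin_indep_def by blast

lemma lin_indep_unique:
  assumes "lin_indep B" "\<And>b. b \<in> B \<Longrightarrow> c b \<in> R" "\<And>b. b \<in> B \<Longrightarrow> c' b \<in> R"
    and "(\<Sum>b\<in>B. c b * b) = (\<Sum>b\<in>B. c' b * b)" "b \<in> B"
  shows "c b = c' b"
proof -
  have "(\<Sum>b\<in>B. (c b + - c' b) * b) = 0"
    using assms(4) by (simp add: algebra_simps sum_subtractf)
  moreover have "\<forall>b\<in>B. c b + - c' b \<in> R"
    using R_add[OF assms(2) R_uminus[OF assms(3)]] by blast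
  ultimately have "c b + - c' b = 0"
    using assms(1,5) unfolding lin_indep_def by (elim allE[of _ "\<lambda>b. c b + - c' b"]) blast
  then show ?thesis by simp
qed

lemma basis_exists:
  assumes "finite S"
  shows "\<exists>B\<subseteq>S. lin_indep B \<and> S \<subseteq> sp B"
proof -
  let ?P = "\<lambda>B. B \<subseteq> S \<and> lin_indep B"
  have "?P {}" by (simp add: lin_indep_def)
  moreover have "\<forall>B. ?P B \<longrightarrow> card B < Suc (card S)" using card_mono[OF assms] by (simp add: less_Suc_eq_le)
  ultimately have "\<exists>B. ?P B \<and> (\<forall>B'. ?P B' \<longrightarrow> card B' \<le> card B)"
    by (rule ex_has_greatest_nat)
  then obtain B where B: "B \<subseteq> S" "lin_indep B" "\<And>B'. ?P B' \<Longrightarrow> card B' \<le> card B" by blast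
  have finB: "finite B" using B(1) assms finite_subset by blast
  have "s \<in> sp B" if s: "s \<in> S" for s
  proof (cases "s \<in> B")
    case True
    then show ?thesis using sp_base finB by blast
  next
    case False
    then have "card (insert s B) > card B" using finB by simp
    then have "\<not> lin_indep (insert s B)" using B(3)[of "insert s B"] B(1) s by auto
    then obtain c where c: "\<And>b. b \<in> insert s B \<Longrightarrow> c b \<in> R" "(\<Sum>b\<in>insert s B. c b * b) = 0"
      "\<exists>b\<in>insert s B. c b \<noteq> 0" unfolding lin_indep_def by blast
    have sum: "c s * s + (\<Sum>b\<in>B. c b * b) = 0" using c(2) False finB by simp
    have "c s \<noteq> 0"
    proof
      assume 0: "c s = 0"
      with sum have "(\<Sum>b\<in>B. c b * b) = 0" by simp
      then have "\<forall>b\<in>B. c b = 0" using B(2) c(1) unfolding lin_indep_def by blast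
      with c(3) 0 show False by auto
    qed
    moreover have "c s * s = (\<Sum>b\<in>B. (- c b) * b)"
      using eq_neg_iff_add_eq_0[THEN iffD2, OF sum] by (simp add: sum_negf)
    ultimately show ?thesis using c(1) by (intro spI[of "c s" B "\<lambda>b. - c b"]) (auto intro: R_uminus)
  qed
  then show ?thesis using B by blast
qed

text \<open>The factor is the same for all of \<open>X\<close>; otherwise the scaling of a product
  would depend on its letters and not only on their number.\<close>

lemma common_denominator:
  assumes "finite X" "X \<subseteq> sp B"
  shows "\<exists>g\<in>R. g \<noteq> 0 \<and> (\<forall>x\<in>X. \<exists>c. (\<forall>b\<in>B. c b \<in> R) \<and> g * x = (\<Sum>b\<in>B. c b * b))"
  using assms
proof (induction X rule: finite_induct)
  case empty
  show ?case by (rule bexI[OF _ R_1]) simp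
next
  case (insert x X)
  have "X \<subseteq> sp B" using insert.prems by simp
  from insert.IH[OF this] obtain g where g: "g \<in> R" "g \<noteq> 0"
    "\<And>x. x \<in> X \<Longrightarrow> \<exists>c. (\<forall>b\<in>B. c b \<in> R) \<and> g * x = (\<Sum>b\<in>B. c b * b)" by blast
  obtain d c where d: "d \<in> R" "d \<noteq> 0" "\<And>s. s \<in> B \<Longrightarrow> c s \<in> R" "d * x = (\<Sum>s\<in>B. c s * s)"
    using spE[of x B] insert.prems by blast
  have scale: "\<exists>c'. (\<forall>b\<in>B. c' b \<in> R) \<and> (a * e) * y = (\<Sum>b\<in>B. c' b * b)"
    if "a \<in> R" "\<forall>b\<in>B. c b \<in> R" "e * y = (\<Sum>b\<in>B. c b * b)" for a e y c
    using that R_mult by (intro exI[of _ "\<lambda>b. a * c b"])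
      (simp add: mult.assoc sum_distrib_left)
  show ?case
  proof (intro bexI[of _ "g * d"] conjI ballI)
    fix y assume "y \<in> insert x X"
    then consider "y = x" | "y \<in> X" by blast
    then show "\<exists>c. (\<forall>b\<in>B. c b \<in> R) \<and> (g * d) * y = (\<Sum>b\<in>B. c b * b)"
    proof cases
      case 1
      then show ?thesis using scale[OF g(1) _ d(4)] d(3) by blast
    next
      case 2
      then obtain c' where "\<forall>b\<in>B. c' b \<in> R" "g * y = (\<Sum>b\<in>B. c' b * b)" using g(3) by blast
      from scale[OF d(1) this] show ?thesis by (simp add: mult.commute)
    qed
  qed (use g d in \<open>auto intro: R_mult\<close>)
qed

text \<open>The row \<open>C a b\<close> divided by \<open>g\<close> lists the coordinates of
  \<open>b * a\<close>, so up to the factor \<open>g\<close> the number \<open>a\<close> becomes a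
  matrix over \<open>R\<close>. A nonzero element of \<open>B\<close> is what later recovers a
  number from its matrix.\<close>

lemma regular_representation:
  assumes "finite E" "\<And>a. a \<in> E \<Longrightarrow> algebraic_over R a"
  obtains B g C where "finite B" "B \<noteq> {}" "0 \<notin> B" "lin_indep B" "g \<in> R" "g \<noteq> 0"
    "\<And>a b b'. a \<in> E \<Longrightarrow> b \<in> B \<Longrightarrow> b' \<in> B \<Longrightarrow> C a b b' \<in> R"
    "\<And>a b. a \<in> E \<Longrightarrow> b \<in> B \<Longrightarrow> g * (b * a) = (\<Sum>b'\<in>B. C a b b' * b')"
proof -
  obtain S where S: "finite S" "1 \<in> S" "\<And>a s. a \<in> E \<Longrightarrow> s \<in> S \<Longrightarrow> a * s \<in> sp S"
    using sp_mult_closed[of E] assms by blast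
  obtain B where B: "B \<subseteq> S" "lin_indep B" "S \<subseteq> sp B"
    using basis_exists[OF S(1)] by blast
  have finB: "finite B" using B(1) S(1) finite_subset by blast
  have 0: "0 \<notin> B"
  proof
    assume "0 \<in> B"
    then have "(if (0::complex) = 0 then 1 else 0) = (0::complex)"
      by (intro lin_indepD[OF B(2), of "\<lambda>b. if b = 0 then 1 else 0" 0])
         (auto intro: R_0 R_1 sum.neutral)
    then show False by simp
  qed
  have ne: "B \<noteq> {}"
  proof
    assume "B = {}"
    moreover have "1 \<in> sp B" using S(2) B(3) by blast
    ultimately show False by (auto elim: spE)
  qed
  define X where "X = (\<lambda>(a, b). b * a) ` (E \<times> B)"
  have "x \<in> sp B" if "x \<in> X" for x
  proof -
    have "x \<in> sp S" using that S(3) B(1) by (auto simp: X_def mult.commute)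
    from sp_trans[OF _ this, of 1 B] show ?thesis using B(3) by auto
  qed
  then have "X \<subseteq> sp B" by blast
  moreover have "finite X" using assms(1) finB by (simp add: X_def)
  ultimately obtain g where g: "g \<in> R" "g \<noteq> 0"
    "\<forall>x\<in>X. \<exists>c. (\<forall>b\<in>B. c b \<in> R) \<and> g * x = (\<Sum>b\<in>B. c b * b)"
    using common_denominator by blast
  then obtain c where c: "\<And>x. x \<in> X \<Longrightarrow> (\<forall>b\<in>B. c x b \<in> R) \<and> g * x = (\<Sum>b\<in>B. c x b * b)"
    by metis
  show thesis
  proof (rule that[of B g "\<lambda>a b. c (b * a)"])
    show "c (b * a) b' \<in> R" if "a \<in> E" "b \<in> B" "b' \<in> B" for a b b'
      using c[of "b * a"] that by (force simp: X_def)
    show "g * (b * a) = (\<Sum>b'\<in>B. c (b * a) b' * b')" if "a \<in> E" "b \<in> B" for a b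
      using c[of "b * a"] that by (force simp: X_def)
  qed (use finB ne 0 B g in auto)
qed

end

section \<open>Reduction of the word problem to integer polynomials\<close>

lemma zringI: "zpoly r D f \<Longrightarrow> f t = x \<Longrightarrow> x \<in> zring r t"
  unfolding zring_def by blast

lemma coeff_ring_zring: "coeff_ring (zring r t)"
proof
  show "1 \<in> zring r t" by (rule zringI[OF zpoly_1]) simp
next
  fix x y assume "x \<in> zring r t" "y \<in> zring r t"
  then obtain f g D E where f: "zpoly r D f" "x = f t" and g: "zpoly r E g" "y = g t"
    unfolding zring_def by blast
  have "zpoly r (max D E) (\<lambda>x. f x + g x)"
    by (intro zpoly_add zpoly_mono[OF f(1)] zpoly_mono[OF g(1)]) auto
  then show "x + y \<in> zring r t" by (rule zringI) (simp add: f g)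
  show "x * y \<in> zring r t" by (rule zringI[OF zpoly_mult[OF f(1) g(1)]]) (simp add: f g)
next
  fix x assume "x \<in> zring r t"
  then obtain f D where f: "zpoly r D f" "x = f t" unfolding zring_def by blast
  show "- x \<in> zring r t" by (rule zringI[OF zpoly_uminus[OF f(1)]]) (simp add: f)
qed

text \<open>Row \<open>j\<close> of the product of the \<open>m\<close> by \<open>m\<close> matrices
  \<open>B i\<close> along \<open>js\<close>, multiplied on the right like the register. The
  dimension \<open>m\<close> results from a choice of basis and is thus a number, not a
  type.\<close>

definition rowp :: "nat \<Rightarrow> (nat \<Rightarrow> nat \<Rightarrow> nat \<Rightarrow> 'a::comm_ring_1) \<Rightarrow> nat \<Rightarrow> nat list \<Rightarrow> nat \<Rightarrow> 'a" where
  "rowp m B j js = foldl (\<lambda>v i l. \<Sum>k<m. v k * B i k l) (\<lambda>l. if j = l then 1 else 0) js"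

lemma rowp_Nil [simp]: "rowp m B j [] l = (if j = l then 1 else 0)"
  and rowp_snoc [simp]: "rowp m B j (js @ [i]) l = (\<Sum>k<m. rowp m B j js k * B i k l)"
  by (simp_all add: rowp_def)

definition prodm :: "(complex ^'n ^'n) list \<Rightarrow> nat list \<Rightarrow> complex ^'n::finite ^'n" where
  "prodm As js = foldl (\<lambda>X i. X ** As ! i) (mat 1) js"

lemma prodm_Nil [simp]: "prodm As [] = mat 1"
  and prodm_snoc [simp]: "prodm As (js @ [i]) = prodm As js ** As ! i"
  by (simp_all add: prodm_def)

lemma word_problem_polynomial:
  fixes As :: "(complex ^'n::finite ^'n) list"
  obtains r t m D B g where "alg_indep r t" "zpoly r D g"
    "\<And>i k l. i < length As \<Longrightarrow> k < m \<Longrightarrow> l < m \<Longrightarrow> zpoly r D (B i k l)"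
    "\<And>js. set js \<subseteq> {..<length As} \<Longrightarrow> prodm As js = mat 1 \<longleftrightarrow>
      (\<forall>j<m. \<forall>l<m. rowp m (\<lambda>i k l. B i k l t) j js l = (if j = l then g t ^ length js else 0))"
proof -
  define E where "E = (\<lambda>(A, p, q). A $ p $ q) ` (set As \<times> UNIV \<times> UNIV)"
  have E: "As ! i $ p $ q \<in> E" if "i < length As" for i p q
    using that unfolding E_def by (force intro!: image_eqI[of _ _ "(As ! i, p, q)"])
  have "finite E" by (simp add: E_def)
  then obtain r t where t: "alg_indep r t" "\<And>a. a \<in> E \<Longrightarrow> algebraic_over (zring r t) a"
    using transcendence_basis by blast
  interpret coeff_ring "zring r t" by (rule coeff_ring_zring)
  obtain Bs G C where Bs: "finite Bs" "Bs \<noteq> {}" "0 \<notin> Bs" "lin_indep Bs" and G: "G \<in> zring r t" "G \<noteq> 0"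
    and C: "\<And>a b b'. a \<in> E \<Longrightarrow> b \<in> Bs \<Longrightarrow> b' \<in> Bs \<Longrightarrow> C a b b' \<in> zring r t"
    "\<And>a b. a \<in> E \<Longrightarrow> b \<in> Bs \<Longrightarrow> G * (b * a) = (\<Sum>b'\<in>Bs. C a b b' * b')"
    using regular_representation[OF \<open>finite E\<close> t(2)] by blast
  \<comment> \<open>Each entry of a matrix is replaced by a block with rows and columns indexed by
    \<open>Bs\<close>; an index of the large matrix is a coordinate together with a basis element,
    and \<open>h\<close> numbers these pairs.\<close>
  define I where "I = (UNIV :: 'n set) \<times> Bs"
  have "finite I" using Bs by (simp add: I_def)
  define m where "m = card I"
  obtain h where h: "bij_betw h {..<m} I"
    using ex_bij_betw_nat_finite[OF \<open>finite I\<close>] by (auto simp: m_def atLeast0LessThan)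
  have hI: "snd (h k) \<in> Bs" if "k < m" for k
  proof -
    have "h k \<in> I" using bij_betwE[OF h] that by simp
    then show ?thesis by (simp add: I_def mem_Times_iff)
  qed
  have "\<exists>d f. zpoly r d f \<and> f t = c" if "c \<in> zring r t" for c
    using that unfolding zring_def by blast
  then obtain pd pf where pf: "\<And>c. c \<in> zring r t \<Longrightarrow> zpoly r (pd c) (pf c) \<and> pf c t = c" by metis
  define M where "M i k l = C (As ! i $ fst (h k) $ fst (h l)) (snd (h k)) (snd (h l))" for i k l
  have M: "M i k l \<in> zring r t" if "i < length As" "k < m" "l < m" for i k l
    unfolding M_def by (intro C(1) E hI that)
  \<comment> \<open>The sum of all degree bounds is a convenient common upper bound.\<close>
  define D where "D = pd G + (\<Sum>i<length As. \<Sum>k<m. \<Sum>l<m. pd (M i k l))"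
  have D: "pd (M i k l) \<le> D" if "i < length As" "k < m" "l < m" for i k l
  proof -
    have "pd (M i k l) \<le> (\<Sum>l<m. pd (M i k l))" using that by (intro member_le_sum) auto
    also have "\<dots> \<le> (\<Sum>k<m. \<Sum>l<m. pd (M i k l))"
      using that by (intro member_le_sum[of k _ "\<lambda>k. \<Sum>l<m. pd (M i k l)"]) auto
    also have "\<dots> \<le> (\<Sum>i<length As. \<Sum>k<m. \<Sum>l<m. pd (M i k l))"
      using that by (intro member_le_sum[of i _ "\<lambda>i. \<Sum>k<m. \<Sum>l<m. pd (M i k l)"]) auto
    finally show ?thesis by (simp add: D_def)
  qed
  let ?row = "rowp m M"
  have row_eq: "rowp m (\<lambda>i k l. pf (M i k l) t) j js l = ?row j js l"
    if "set js \<subseteq> {..<length As}" "l < m" for j js l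
    using that
    by (induction js arbitrary: l rule: rev_induct) (auto intro!: sum.cong simp: pf M)
  have row_R: "?row j js l \<in> zring r t" if "set js \<subseteq> {..<length As}" "l < m" for j js l
    using that
  proof (induction js arbitrary: l rule: rev_induct)
    case (snoc i xs)
    have "(\<Sum>k\<in>K. ?row j xs k * M i k l) \<in> zring r t" if "K \<subseteq> {..<m}" for K
      using that finite_subset[OF that] snoc by (induction K rule: infinite_finite_induct)
        (auto intro!: R_0 R_add R_mult M)
    then show ?case by simp
  qed (auto intro: R_0 R_1)
  \<comment> \<open>With \<open>h j = (p, b)\<close>, row \<open>j\<close> lists in the columns
    \<open>(q, b')\<close> the \<open>Bs\<close>-coordinates of \<open>G ^ length js * b\<close>
    times entry \<open>(p, q)\<close> of the word. Each appended letter costs one more factor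
    \<open>G\<close> to clear denominators.\<close>
  have key: "G ^ length js * (snd (h j) * prodm As js $ fst (h j) $ q) =
      (\<Sum>b\<in>Bs. ?row j js (inv_into {..<m} h (q, b)) * b)"
    if "set js \<subseteq> {..<length As}" "j < m" for j q js
    using that
  proof (induction js arbitrary: q rule: rev_induct)
    case Nil
    have "j = inv_into {..<m} h (q, b) \<longleftrightarrow> h j = (q, b)" if "b \<in> Bs" for b
      using h that Nil(2) unfolding I_def
      by (metis (no_types, lifting) SigmaI UNIV_I bij_betw_inv_into_left bij_betw_inv_into_right lessThan_iff)
    then have "(\<Sum>b\<in>Bs. ?row j [] (inv_into {..<m} h (q, b)) * b) = (\<Sum>b\<in>Bs. if b = snd (h j) then (if q = fst (h j) then b else 0) else 0)"
      by (intro sum.cong) (auto simp: prod_eq_iff)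
    also have "\<dots> = (if q = fst (h j) then snd (h j) else 0)"
      using Bs(1) hI[OF Nil(2)] by simp
    finally show ?case by (simp add: mat_def)
  next
    case (snoc i xs)
    have i: "i < length As" and xs: "set xs \<subseteq> {..<length As}" using snoc.prems by auto
    let ?p = "fst (h j)" and ?b = "snd (h j)" and ?n = "length xs"
    let ?inv = "inv_into {..<m} h"
    have "G ^ length (xs @ [i]) * (?b * prodm As (xs @ [i]) $ ?p $ q)
       = (\<Sum>q'\<in>UNIV. G * (G ^ ?n * (?b * prodm As xs $ ?p $ q')) * As ! i $ q' $ q)"
      by (simp add: matrix_matrix_mult_def sum_distrib_left mult_ac)
    also have "\<dots> = (\<Sum>q'\<in>UNIV. G * (\<Sum>b\<in>Bs. ?row j xs (?inv (q', b)) * b) * As ! i $ q' $ q)"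
      using snoc.IH[OF xs snoc.prems(2)] by simp
    also have "\<dots> = (\<Sum>q'\<in>UNIV. \<Sum>b\<in>Bs. ?row j xs (?inv (q', b)) * (G * (b * As ! i $ q' $ q)))"
      by (simp add: sum_distrib_left sum_distrib_right mult_ac)
    also have "\<dots> = (\<Sum>q'\<in>UNIV. \<Sum>b\<in>Bs. ?row j xs (?inv (q', b)) * (\<Sum>b'\<in>Bs. C (As ! i $ q' $ q) b b' * b'))"
      by (intro sum.cong refl) (simp add: C(2) E[OF i])
    also have "\<dots> = (\<Sum>x\<in>I. ?row j xs (?inv x) * (\<Sum>b'\<in>Bs. C (As ! i $ fst x $ q) (snd x) b' * b'))"
      unfolding I_def by (simp add: sum.cartesian_product split_def)
    also have "\<dots> = (\<Sum>k<m. ?row j xs (?inv (h k)) * (\<Sum>b'\<in>Bs. C (As ! i $ fst (h k) $ q) (snd (h k)) b' * b'))"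
      by (rule sum.reindex_bij_betw[OF h, symmetric])
    also have "\<dots> = (\<Sum>k<m. ?row j xs k * (\<Sum>b'\<in>Bs. M i k (?inv (q, b')) * b'))"
    proof (intro sum.cong refl)
      fix k assume k: "k \<in> {..<m}"
      have "C (As ! i $ fst (h k) $ q) (snd (h k)) b' = M i k (?inv (q, b'))" if "b' \<in> Bs" for b'
        using bij_betw_inv_into_right[OF h, of "(q, b')"] that by (simp add: M_def I_def)
      then show "?row j xs (?inv (h k)) * (\<Sum>b'\<in>Bs. C (As ! i $ fst (h k) $ q) (snd (h k)) b' * b')
         = ?row j xs k * (\<Sum>b'\<in>Bs. M i k (?inv (q, b')) * b')"
        using bij_betw_inv_into_left[OF h k] by simp
    qed
    also have "\<dots> = (\<Sum>b'\<in>Bs. \<Sum>k<m. ?row j xs k * (M i k (?inv (q, b')) * b'))"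
      by (simp add: sum_distrib_left) (rule sum.swap)
    also have "\<dots> = (\<Sum>b'\<in>Bs. ?row j (xs @ [i]) (?inv (q, b')) * b')"
      by (simp add: sum_distrib_right mult.assoc)
    finally show ?case .
  qed
  have word: "prodm As js = mat 1 \<longleftrightarrow> (\<forall>j<m. \<forall>l<m. ?row j js l = (if j = l then G ^ length js else 0))"
    if js: "set js \<subseteq> {..<length As}" for js
  proof
    let ?inv = "inv_into {..<m} h"
    assume 1: "prodm As js = mat 1"
    show "\<forall>j<m. \<forall>l<m. ?row j js l = (if j = l then G ^ length js else 0)"
    proof (intro allI impI)
      fix j l assume j: "j < m" and l: "l < m"
      let ?q = "fst (h l)"
      \<comment> \<open>Both families expand the same number in \<open>Bs\<close>, so linear
        independence makes them agree, in particular at \<open>snd (h l)\<close>.\<close>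
      let ?c' = "\<lambda>b. if h j = (?q, b) then G ^ length js else 0"
      have "(\<Sum>b\<in>Bs. ?c' b * b) = (\<Sum>b\<in>Bs. if b = snd (h j) then (if fst (h j) = ?q then G ^ length js * b else 0) else 0)"
        by (intro sum.cong) (auto simp: prod_eq_iff)
      also have "\<dots> = (if fst (h j) = ?q then G ^ length js * snd (h j) else 0)"
        using Bs(1) hI[OF j] by simp
      also have "\<dots> = G ^ length js * (snd (h j) * prodm As js $ fst (h j) $ ?q)"
        by (simp add: 1 mat_def)
      finally have "(\<Sum>b\<in>Bs. ?row j js (?inv (?q, b)) * b) = (\<Sum>b\<in>Bs. ?c' b * b)"
        using key[OF js j, of ?q] by simp
      moreover have "?inv (?q, b) < m" if "b \<in> Bs" for b
        using bij_betwE[OF bij_betw_inv_into[OF h]] that by (auto simp: I_def)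
      moreover have "G ^ n \<in> zring r t" for n by (induction n) (auto intro: R_1 R_mult G)
      ultimately have "?row j js (?inv (?q, snd (h l))) = ?c' (snd (h l))"
        by (intro lin_indep_unique[OF Bs(4), of "\<lambda>b. ?row j js (?inv (?q, b))" ?c'])
           (use hI[OF l] in \<open>auto intro: row_R[OF js] R_0\<close>)
      moreover have "?inv (?q, snd (h l)) = l" using bij_betw_inv_into_left[OF h] l by simp
      moreover have "h j = h l \<longleftrightarrow> j = l"
        using bij_betw_imp_inj_on[OF h] j l by (auto dest: inj_onD)
      ultimately show "?row j js l = (if j = l then G ^ length js else 0)" by simp
    qed
  next
    let ?inv = "inv_into {..<m} h"
    assume rows: "\<forall>j<m. \<forall>l<m. ?row j js l = (if j = l then G ^ length js else 0)"
    \<comment> \<open>The nonzero factor \<open>G ^ length js * b\<close> can be cancelled, which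
      turns coordinates back into an entry of the word.\<close>
    obtain b where b: "b \<in> Bs" "b \<noteq> 0" using Bs by blast
    show "prodm As js = mat 1"
    proof (unfold vec_eq_iff, intro allI)
      fix p q
      define j where "j = ?inv (p, b)"
      have j: "j < m" "h j = (p, b)"
        using bij_betwE[OF bij_betw_inv_into[OF h]] bij_betw_inv_into_right[OF h] b
        by (auto simp: I_def j_def)
      have inv: "?inv (q, b') < m \<and> h (?inv (q, b')) = (q, b')" if "b' \<in> Bs" for b'
        using bij_betwE[OF bij_betw_inv_into[OF h]] bij_betw_inv_into_right[OF h] that
        by (auto simp: I_def)
      have "G ^ length js * (b * prodm As js $ p $ q) = (\<Sum>b'\<in>Bs. ?row j js (?inv (q, b')) * b')"
        using key[OF js j(1), of q] j by simp
      also have "\<dots> = (\<Sum>b'\<in>Bs. if b' = b then (if p = q then G ^ length js * b else 0) else 0)"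
      proof (intro sum.cong refl)
        fix b' assume b': "b' \<in> Bs"
        have iff: "j = ?inv (q, b') \<longleftrightarrow> p = q \<and> b' = b"
        proof
          assume "j = ?inv (q, b')"
          then have "h j = (q, b')" using inv[OF b'] by metis
          then show "p = q \<and> b' = b" using j(2) by simp
        qed (simp add: j_def)
        have "?row j js (?inv (q, b')) = (if p = q \<and> b' = b then G ^ length js else 0)"
          using rows[rule_format, OF j(1), of "?inv (q, b')"] inv[OF b'] unfolding iff by blast
        then show "?row j js (?inv (q, b')) * b' = (if b' = b then (if p = q then G ^ length js * b else 0) else 0)"
          by simp
      qed
      also have "\<dots> = (if p = q then G ^ length js * b else 0)" using Bs(1) b by simp
      finally show "prodm As js $ p $ q = mat 1 $ p $ q"
        using b(2) G(2) by (auto simp: mat_def split: if_splits)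
    qed
  qed
  show thesis
  proof (rule that[of r t D "pf G" m "\<lambda>i k l. pf (M i k l)"])
    show "zpoly r D (pf G)" using zpoly_mono[of r "pd G" "pf G" D] pf[OF G(1)] by (simp add: D_def)
    show "zpoly r D (pf (M i k l))" if "i < length As" "k < m" "l < m" for i k l
      using zpoly_mono[OF conjunct1[OF pf[OF M[OF that]]] D[OF that]] .
    show "prodm As js = mat 1 \<longleftrightarrow>
      (\<forall>j<m. \<forall>l<m. rowp m (\<lambda>i k l. pf (M i k l) t) j js l = (if j = l then pf G t ^ length js else 0))"
      if "set js \<subseteq> {..<length As}" for js
      using word[OF that] row_eq[OF that] pf[OF G(1)] by simp
  qed (rule t(1))
qed

lemma zpoly_rowp:
  assumes "\<And>i k l. i \<in> set js \<Longrightarrow> k < m \<Longrightarrow> l < m \<Longrightarrow> zpoly r D (B i k l)" "l < m"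
  shows "zpoly r (D * length js) (\<lambda>x. rowp m (\<lambda>i k l. B i k l x) j js l)"
  using assms
proof (induction js arbitrary: l rule: rev_induct)
  case Nil
  then show ?case using zpoly_0 zpoly_1 by simp
next
  case (snoc i xs)
  have "zpoly r (D * length xs + D) (\<lambda>x. \<Sum>k<m. rowp m (\<lambda>i k l. B i k l x) j xs k * B i k l x)"
    by (intro zpoly_sum zpoly_mult snoc) (use snoc.prems in auto)
  then show ?case by (simp add: add.commute)
qed

lemma word_problem_grid:
  fixes As :: "(complex ^'n::finite ^'n) list"
  obtains r m D B g where "zpoly r D g"
    "\<And>i k l. i < length As \<Longrightarrow> k < m \<Longrightarrow> l < m \<Longrightarrow> zpoly r D (B i k l)"
    "\<And>js. set js \<subseteq> {..<length As} \<Longrightarrow> prodm As js = mat 1 \<longleftrightarrow>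
      (\<forall>y<Suc (D * length js) ^ r. (\<forall>j<m. \<forall>l<m.
         rowp m (\<lambda>i k l. B i k l (\<lambda>i. of_nat (digit (Suc (D * length js)) y i))) j js l = 
           (if j = l then g (\<lambda>i. of_nat (digit (Suc (D * length js)) y i)) ^ length js else 0)))"
proof -
  from word_problem_polynomial[of As] obtain r t m D B g where t: "alg_indep r t" and g: "zpoly r D g"
    and B: "\<And>i k l. i < length As \<Longrightarrow> k < m \<Longrightarrow> l < m \<Longrightarrow> zpoly r D (B i k l)"
    and w: "\<And>js. set js \<subseteq> {..<length As} \<Longrightarrow> prodm As js = mat 1 \<longleftrightarrow>
      (\<forall>j<m. \<forall>l<m. rowp m (\<lambda>i k l. B i k l t) j js l = (if j = l then g t ^ length js else 0))"
    by this (rule that)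
  show thesis
  proof (rule that[OF g B])
    fix js assume js: "set js \<subseteq> {..<length As}"
    define f where "f j l x = rowp m (\<lambda>i k l. B i k l x) j js l - (if j = l then g x ^ length js else 0)"
      for j l x
    have f: "zpoly r (D * length js) (f j l)" if "l < m" for j l
    proof -
      have "zpoly r (D * length js) (\<lambda>x. if j = l then g x ^ length js else 0)"
        by (cases "j = l") (auto intro: zpoly_power[OF g] zpoly_0)
      then show ?thesis unfolding f_def[abs_def]
        by (intro zpoly_diff zpoly_rowp) (use that js B in auto)
    qed
    \<comment> \<open>Algebraic independence makes vanishing at \<open>t\<close> spread to every
      point; conversely the degree bound \<open>D * length js\<close> makes vanishing on the grid
      spread to \<open>t\<close>.\<close>
    have vanish: "f j l t = 0 \<longleftrightarrow> (\<forall>y<Suc (D * length js) ^ r. f j l (\<lambda>i. of_nat (digit (Suc (D * length js)) y i)) = 0)"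
      if "l < m" for j l
    proof
      assume "f j l t = 0"
      then show "\<forall>y<Suc (D * length js) ^ r. f j l (\<lambda>i. of_nat (digit (Suc (D * length js)) y i)) = 0"
        using t f[OF that] unfolding alg_indep_def by blast
    next
      assume "\<forall>y<Suc (D * length js) ^ r. f j l (\<lambda>i. of_nat (digit (Suc (D * length js)) y i)) = 0"
      then show "f j l t = 0" using zpoly_grid_digits[OF f[OF that], where x = t] by blast
    qed
    have "prodm As js = mat 1 \<longleftrightarrow> (\<forall>j<m. \<forall>l<m. f j l t = 0)"
      by (simp add: w[OF js] f_def)
    also have "\<dots> \<longleftrightarrow> (\<forall>j<m. \<forall>l<m. \<forall>y<Suc (D * length js) ^ r. f j l (\<lambda>i. of_nat (digit (Suc (D * length js)) y i)) = 0)"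
      by (simp add: vanish)
    also have "\<dots> \<longleftrightarrow> (\<forall>y<Suc (D * length js) ^ r. (\<forall>j<m. \<forall>l<m. f j l (\<lambda>i. of_nat (digit (Suc (D * length js)) y i)) = 0))"
      by blast
    finally show "prodm As js = mat 1 \<longleftrightarrow>
      (\<forall>y<Suc (D * length js) ^ r. (\<forall>j<m. \<forall>l<m.
         rowp m (\<lambda>i k l. B i k l (\<lambda>i. of_nat (digit (Suc (D * length js)) y i))) j js l =
           (if j = l then g (\<lambda>i. of_nat (digit (Suc (D * length js)) y i)) ^ length js else 0)))"
      unfolding f_def right_minus_eq .
  qed auto
qed

section \<open>Decidability of the languages in the class\<close>

lemma wcomp_digit [wcomp_intros]:
  "wcomp N \<Longrightarrow> wcomp x \<Longrightarrow> wcomp i \<Longrightarrow> wcomp (\<lambda>n. digit (N n) (x n) (i n))"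
  unfolding digit_def by (intro wcomp_intros)

lemma icomp_zpoly:
  assumes "zpoly r D f" "\<And>i. i < r \<Longrightarrow> wcomp (\<lambda>n. s n i)"
  shows "\<exists>h. icomp h \<and> (\<forall>n. f (\<lambda>i. of_nat (s n i)) = of_int (h n))"
  using assms(1)
proof (induction rule: zpoly.induct)
  case (zpoly_const D c)
  show ?case by (intro exI[of _ "\<lambda>_. c"]) (auto intro: icomp_const)
next
  case (zpoly_var i D)
  then show ?case using icomp_int[OF assms(2)] by (intro exI[of _ "\<lambda>n. int (s n i)"]) auto
next
  case (zpoly_add D f g)
  then obtain h h' where "icomp h" "icomp h'" "\<forall>n. f (\<lambda>i. of_nat (s n i)) = of_int (h n)"
    "\<forall>n. g (\<lambda>i. of_nat (s n i)) = of_int (h' n)" by blast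
  then show ?case by (intro exI[of _ "\<lambda>n. h n + h' n"]) (auto intro: icomp_add)
next
  case (zpoly_mult D f E g)
  then obtain h h' where "icomp h" "icomp h'" "\<forall>n. f (\<lambda>i. of_nat (s n i)) = of_int (h n)"
    "\<forall>n. g (\<lambda>i. of_nat (s n i)) = of_int (h' n)" by blast
  then show ?case by (intro exI[of _ "\<lambda>n. h n * h' n"]) (auto intro: icomp_mult)
qed

section \<open>Words over a finite index set coded by numbers\<close>

definition digits :: "nat \<Rightarrow> nat \<Rightarrow> nat \<Rightarrow> nat list" where
  "digits N k x = map (digit N x) [0..<k]"

lemma length_digits [simp]: "length (digits N k x) = k"
  by (simp add: digits_def)

lemma digits_Suc: "digits N (Suc k) x = digits N k x @ [digit N x k]"
  by (simp add: digits_def)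

lemma set_digits: "x < N ^ k \<Longrightarrow> set (digits N k x) \<subseteq> {..<N}"
  by (cases "N = 0"; cases k) (auto simp: digits_def digit_less)

lemma digits_surj:
  assumes "set js \<subseteq> {..<N}"
  shows "\<exists>x<N ^ length js. digits N (length js) x = js"
proof -
  obtain x where x: "x < N ^ length js" "\<forall>i<length js. digit N x i = js ! i"
    using digits_exist[of "length js" "\<lambda>i. js ! i" N] assms nth_mem by fastforce
  then have "digits N (length js) x = js"
    by (intro nth_equalityI) (auto simp: digits_def)
  with x(1) show ?thesis by blast
qed

text \<open>The reversed version takes the digits from the last to the first; it serves the right
  fold that assembles the code of an input word.\<close>

lemma wcomp_foldl_digits:
  assumes h: "wcomp (\<lambda>z. h (pfst z) (psnd z))"
  shows "wcomp (\<lambda>n. foldl h a (digits N (pfst n) (psnd n)))"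
    and "wcomp (\<lambda>n. foldl h a (rev (digits N (pfst n) (psnd n))))"
proof -
  define F where "F x z = pair (Suc (pfst z)) (h (psnd z) (digit N x (pfst z)))" for x z
  have F: "(F x ^^ k) (pair 0 a) = pair k (foldl h a (digits N k x))" for k x
    by (induction k) (auto simp: F_def digits_Suc digits_def)
  have "wcomp (\<lambda>n. psnd ((F (psnd n) ^^ pfst n) (pair 0 a)))"
    unfolding F_def by (intro wcomp_intros wcomp_comp2[OF h])
  then show "wcomp (\<lambda>n. foldl h a (digits N (pfst n) (psnd n)))" by (simp add: F)
next
  define F where "F n z = pair (Suc (pfst z)) (h (psnd z) (digit N (psnd n) (pfst n - Suc (pfst z))))" for n z
  have F: "j \<le> pfst n \<Longrightarrow> (F n ^^ j) (pair 0 a) =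
      pair j (foldl h a (map (\<lambda>i. digit N (psnd n) (pfst n - Suc i)) [0..<j]))" for j n
    by (induction j) (auto simp: F_def)
  have rev: "map (\<lambda>i. digit N x (k - Suc i)) [0..<k] = rev (digits N k x)" for k x
    by (rule nth_equalityI) (auto simp: digits_def rev_nth)
  have "wcomp (\<lambda>n. psnd ((F n ^^ pfst n) (pair 0 a)))"
    unfolding F_def by (intro wcomp_intros wcomp_comp2[OF h])
  then show "wcomp (\<lambda>n. foldl h a (rev (digits N (pfst n) (psnd n))))" by (simp add: F rev)
qed

lemma rowp_of_int: "of_int (rowp m M j js l) = rowp m (\<lambda>i k l. of_int (M i k l)) j js l"
  by (induction js arbitrary: l rule: rev_induct) auto

lemma rowp_cong:
  assumes "\<And>i k l. i \<in> set js \<Longrightarrow> k < m \<Longrightarrow> l < m \<Longrightarrow> M i k l = M' i k l" "l < m"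
  shows "rowp m M j js l = rowp m M' j js l"
  using assms by (induction js arbitrary: l rule: rev_induct) auto

lemma wdec_word_problem:
  fixes As :: "(complex ^'n::finite ^'n) list"
  defines "N \<equiv> length As"
  obtains P where "wdec (\<lambda>z. P (pfst z) (psnd z))"
    "\<And>k x. x < N ^ k \<Longrightarrow> P k x \<longleftrightarrow> prodm As (digits N k x) = mat 1"
proof -
  from word_problem_grid[of As, folded N_def] obtain r m D B g where g: "zpoly r D g"
    and B: "\<And>i k l. i < N \<Longrightarrow> k < m \<Longrightarrow> l < m \<Longrightarrow> zpoly r D (B i k l)"
    and word: "\<And>js. set js \<subseteq> {..<N} \<Longrightarrow> prodm As js = mat 1 \<longleftrightarrow>
      (\<forall>y<Suc (D * length js) ^ r. \<forall>j<m. \<forall>l<m.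
         rowp m (\<lambda>i k l. B i k l (\<lambda>i. of_nat (digit (Suc (D * length js)) y i))) j js l =
           (if j = l then g (\<lambda>i. of_nat (digit (Suc (D * length js)) y i)) ^ length js else 0))"
    by this (rule that)
  \<comment> \<open>The argument has the form \<open>pair (pair k x) y\<close>: a word of length
    \<open>k\<close> coded by \<open>x\<close>, and a grid point coded by \<open>y\<close>.\<close>
  define s where "s n i = digit (Suc (D * pfst (pfst n))) (psnd n) i" for n i
  have s: "wcomp (\<lambda>n. s n i)" for i unfolding s_def by (intro wcomp_intros)
  obtain hg where hg: "icomp hg" "\<And>n. g (\<lambda>i. of_nat (s n i)) = of_int (hg n)"
    using icomp_zpoly[where s = s, OF g s] by blast
  have "\<exists>h. icomp h \<and> (i < N \<longrightarrow> k < m \<longrightarrow> l < m \<longrightarrow> (\<forall>n. B i k l (\<lambda>i. of_nat (s n i)) = of_int (h n)))"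
    for i k l
    using icomp_zpoly[where s = s, OF B s, of i k l] icomp_const by blast
  then obtain h where h: "\<And>i k l. icomp (h i k l)"
    "\<And>i k l n. i < N \<Longrightarrow> k < m \<Longrightarrow> l < m \<Longrightarrow> B i k l (\<lambda>i. of_nat (s n i)) = of_int (h i k l n)"
    by metis
  \<comment> \<open>The default 0 gives the form of \<open>icomp_table\<close>; digits of an
    admissible word code are below \<open>N\<close>, so it never enters a product.\<close>
  define H where "H n i k l = (if i < N then h i k l n else 0)" for n i k l
  define js where "js n = digits N (pfst (pfst n)) (psnd (pfst n))" for n
  have row: "icomp (\<lambda>n. rowp m (H n) j (js n) l)" if "l < m" for j l
  proof -
    define x where "x n c l = rowp m (H n) j (digits N c (psnd (pfst n))) l" for n c l
    have "icomp (\<lambda>n. x n (pfst (pfst n)) l)"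
    proof (rule icomp_linear_recurrence[where c = "\<lambda>k l n c. H n (digit N (psnd (pfst n)) c) k l"])
      show "icomp (\<lambda>z. H (pfst z) (digit N (psnd (pfst (pfst z))) (psnd z)) k l)" for k l
        unfolding H_def
        by (rule icomp_table) (intro icomp_comp[OF h(1)] wcomp_intros)+
      show "x n 0 l = (if j = l then 1 else 0)" for n l
        by (simp add: x_def digits_def)
      show "x n (Suc c) l = (\<Sum>k<m. x n c k * H n (digit N (psnd (pfst n)) c) k l)" for n c l
        by (simp add: x_def digits_Suc)
      show "wcomp (\<lambda>n. pfst (pfst n))" by (intro wcomp_intros)
    qed (rule that)
    then show ?thesis by (simp add: x_def js_def)
  qed
  define Q where "Q n \<longleftrightarrow> (\<forall>j<m. \<forall>l<m. rowp m (H n) j (js n) l =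
      (if j = l then hg n ^ pfst (pfst n) else 0))" for n
  have "icomp (\<lambda>n. if j = l then hg n ^ pfst (pfst n) else 0)" for j l :: nat
  proof (cases "j = l")
    case True
    then show ?thesis using icomp_power[OF hg(1)] by (simp add: wcomp_intros)
  qed (simp add: icomp_const)
  then have Q: "wdec Q" unfolding Q_def[abs_def]
    by (intro wdec_All_less wdec_int_eq row)
  have Q_iff: "Q n \<longleftrightarrow> (\<forall>j<m. \<forall>l<m. rowp m (\<lambda>i k l. B i k l (\<lambda>i. of_nat (s n i))) j (js n) l =
      (if j = l then g (\<lambda>i. of_nat (s n i)) ^ pfst (pfst n) else 0))"
    if "set (js n) \<subseteq> {..<N}" for n
  proof -
    have "rowp m (\<lambda>i k l. B i k l (\<lambda>i. of_nat (s n i))) j (js n) l = of_int (rowp m (H n) j (js n) l)"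
      if "l < m" for j l
      unfolding rowp_of_int
      by (rule rowp_cong) (use that \<open>set (js n) \<subseteq> {..<N}\<close> in \<open>auto simp: H_def h(2)\<close>)
    moreover have "(if j = l then g (\<lambda>i. of_nat (s n i)) ^ pfst (pfst n) else 0) =
        of_int (if j = l then hg n ^ pfst (pfst n) else 0)" for j l :: nat
      by (simp add: hg(2))
    ultimately show ?thesis unfolding Q_def by (simp del: of_int_power)
  qed
  show thesis
  proof (rule that)
    show "wdec (\<lambda>z. \<forall>y<Suc (D * pfst z) ^ r. Q (pair (pair (pfst z) (psnd z)) y))"
      by (intro wdec_ball wdec_comp[OF Q] wcomp_intros)
    show "(\<forall>y<Suc (D * k) ^ r. Q (pair (pair k x) y)) \<longleftrightarrow> prodm As (digits N k x) = mat 1"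
      if "x < N ^ k" for k x
      using word[OF set_digits[OF that]] Q_iff[of "pair (pair k x) _"] set_digits[OF that]
      by (simp add: js_def s_def)
  qed
qed

text \<open>The state \<open>q\<close> is coded as \<open>Suc q\<close>; \<open>0\<close> marks a path that has left the transition graph.\<close>
definition step_code :: "'n trans list \<Rightarrow> nat \<Rightarrow> nat \<Rightarrow> nat" where
  "step_code ts st i = (if st = Suc (fst (ts ! i)) then Suc (fst (snd (snd (ts ! i)))) else 0)"

text \<open>\<open>Suc (pair a w)\<close> is the recursion of \<open>list_encode\<close>, so a right
  fold along a path yields the code of the word that it reads.\<close>

definition read_code :: "'n trans list \<Rightarrow> nat \<Rightarrow> nat \<Rightarrow> nat" where
  "read_code ts w i = (case fst (snd (ts ! i)) of None \<Rightarrow> w | Some a \<Rightarrow> Suc (pair a w))"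

text \<open>A computation becomes a list of transition indices checked by three separate folds, for
  state, input and register. Only the register fold involves complex numbers, and from the identity
  it is an instance of the word problem.\<close>

lemma comp_iff_path:
  fixes ts :: "('n::finite) trans list"
  defines "As \<equiv> map (snd \<circ> snd \<circ> snd) ts"
  shows "comp (set ts) q x w q' y k \<longleftrightarrow>
    (\<exists>js. length js = k \<and> set js \<subseteq> {..<length ts} \<and> foldl (step_code ts) (Suc q) js = Suc q' \<and>
      foldr (\<lambda>i w. read_code ts w i) js 0 = list_encode w \<and> foldl (\<lambda>X i. X ** As ! i) x js = y)"
    (is "?L \<longleftrightarrow> ?R")
proof
  assume ?L
  then show ?R
  proof induction
    case (comp_nil q x)
    show ?case by simp
  next
    case (comp_eps q q' m x w q'' y k)
    then obtain i where i: "i < length ts" "ts ! i = (q, None, q', m)"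
      by (metis in_set_conv_nth)
    obtain js where "length js = k \<and> set js \<subseteq> {..<length ts} \<and> foldl (step_code ts) (Suc q') js = Suc q'' \<and>
      foldr (\<lambda>i w. read_code ts w i) js 0 = list_encode w \<and> foldl (\<lambda>X i. X ** As ! i) (x ** m) js = y"
      using comp_eps.IH by blast
    moreover have "step_code ts (Suc q) i = Suc q'" "\<And>v. read_code ts v i = v" "As ! i = m"
      using i by (simp_all add: step_code_def read_code_def As_def)
    ultimately show ?case using i(1) by (intro exI[of _ "i # js"]) auto
  next
    case (comp_read q a q' m x w q'' y k)
    then obtain i where i: "i < length ts" "ts ! i = (q, Some a, q', m)"
      by (metis in_set_conv_nth)
    obtain js where "length js = k \<and> set js \<subseteq> {..<length ts} \<and> foldl (step_code ts) (Suc q') js = Suc q'' \<and>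
      foldr (\<lambda>i w. read_code ts w i) js 0 = list_encode w \<and> foldl (\<lambda>X i. X ** As ! i) (x ** m) js = y"
      using comp_read.IH by blast
    moreover have "step_code ts (Suc q) i = Suc q'" "\<And>v. read_code ts v i = Suc (pair a v)" "As ! i = m"
      using i by (simp_all add: step_code_def read_code_def As_def)
    ultimately show ?case using i(1) by (intro exI[of _ "i # js"]) (auto simp: pair_def)
  qed
next
  have stuck: "foldl (step_code ts) 0 js = 0" for js
    by (induction js) (auto simp: step_code_def)
  assume ?R
  then obtain js where "length js = k" "set js \<subseteq> {..<length ts}" "foldl (step_code ts) (Suc q) js = Suc q'"
      "foldr (\<lambda>i w. read_code ts w i) js 0 = list_encode w" "foldl (\<lambda>X i. X ** As ! i) x js = y" by blast
  then show ?L
  proof (induction js arbitrary: q x w k)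
    case Nil
    then have "w = []" by (metis foldr_Nil id_apply list_encode.simps(1) list_encode_inverse)
    with Nil show ?case by (auto intro: comp_nil)
  next
    case (Cons i js)
    obtain q1 s q2 m where t: "ts ! i = (q1, s, q2, m)" by (metis prod_cases4)
    have i: "i < length ts" using Cons.prems by simp
    have q1: "q1 = q"
    proof (rule ccontr)
      assume "q1 \<noteq> q"
      then have "step_code ts (Suc q) i = 0" by (simp add: step_code_def t)
      then show False using Cons.prems(3) stuck by simp
    qed
    have step: "foldl (step_code ts) (Suc q2) js = Suc q'"
    proof -
      have "step_code ts (Suc q) i = Suc q2" by (simp add: step_code_def t q1)
      then show ?thesis using Cons.prems(3) by simp
    qed
    have mem: "(q, s, q2, m) \<in> set ts" using i t q1 nth_mem by force
    obtain k' where k': "k = Suc k'" "length js = k'" using Cons.prems(1) by auto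
    have sub: "set js \<subseteq> {..<length ts}" and fin: "foldl (\<lambda>X i. X ** As ! i) (x ** m) js = y"
      using Cons.prems i by (auto simp: As_def t)
    \<comment> \<open>Surjectivity of \<open>list_encode\<close> supplies the word read by the
      remaining path.\<close>
    obtain v where v: "foldr (\<lambda>i w. read_code ts w i) js 0 = list_encode v"
      by (metis list_decode_inverse)
    have rest: "comp (set ts) q2 (x ** m) v q' y k'"
      by (rule Cons.IH[OF k'(2) sub step v fin])
    have w: "list_encode w = (case s of None \<Rightarrow> list_encode v | Some a \<Rightarrow> list_encode (a # v))"
      using Cons.prems(4) v by (auto simp: read_code_def t pair_def split: option.splits)
    show ?case
    proof (cases s)
      case None
      then have "w = v" using w by (simp add: inj_eq[OF inj_list_encode])
      then show ?thesis using mem rest k' None by (auto intro: comp_eps)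
    next
      case (Some a)
      then have "w = a # v" using w by (simp only: option.case inj_eq[OF inj_list_encode])
      then show ?thesis using mem rest k' Some by (auto intro: comp_read)
    qed
  qed
qed

text \<open>This lets the code itself replace the word length in the bound on the number of
  steps.\<close>

lemma length_le_list_encode: "length w \<le> list_encode w"
proof (induction w)
  case (Cons a w)
  then show ?case using le_prod_encode_2[of "list_encode w" a] by simp
qed simp

text \<open>This yields a bound that holds everywhere and is computable although \<open>t\<close>
  may not be: the finitely many values before the estimate sets in are absorbed into the constant
  \<open>b\<close>.\<close>

lemma bigo_linear_bound:
  assumes "(\<lambda>n. real (t n)) \<in> O(\<lambda>n. real n)"
  obtains a b where "\<And>n. t n \<le> a * n + b"
proof -
  obtain c where "eventually (\<lambda>n. norm (real (t n)) \<le> c * norm (real n)) at_top"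
    using landau_o.bigE[OF assms] by blast
  then obtain n0 where n0: "\<And>n. n \<ge> n0 \<Longrightarrow> real (t n) \<le> c * real n"
    by (auto simp: eventually_at_top_linorder)
  have "t n \<le> nat \<lceil>c\<rceil> * n + (\<Sum>i<n0. t i)" for n
  proof (cases "n < n0")
    case True
    then have "t n \<le> (\<Sum>i<n0. t i)" by (intro member_le_sum) auto
    then show ?thesis by simp
  next
    case False
    then have "real (t n) \<le> c * real n" using n0 by simp
    also have "\<dots> \<le> real (nat \<lceil>c\<rceil>) * real n" by (intro mult_right_mono) linarith+
    finally have "t n \<le> nat \<lceil>c\<rceil> * n" by (simp flip: of_nat_mult)
    then show ?thesis by simp
  qed
  with that show thesis by blast
qed

lemma wdec_lin_time:
  fixes G :: "(complex ^'n::finite ^'n) set"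
  assumes "(\<Sigma>, L) \<in> lin_time_class G"
  shows "wdec (\<lambda>c. c \<in> list_encode ` L)"
proof -
  obtain Q \<delta> q0 Qa t where aut: "G_automaton G Q \<Sigma> \<delta> q0 Qa" and L: "L = lang \<delta> q0 Qa"
    and t: "(\<lambda>n. real (t n)) \<in> O(\<lambda>n. real n)" and bound: "weakly_time_bounded \<delta> q0 Qa t"
    using assms by (auto simp: lin_time_class_def)
  have "finite \<delta>" "finite Qa" using aut finite_subset by (auto simp: G_automaton_def)
  then obtain ts where ts: "set ts = \<delta>" using finite_list by blast
  obtain qs where qs: "set qs = Qa" using \<open>finite Qa\<close> finite_list by blast
  define As where "As = map (snd \<circ> snd \<circ> snd) ts"
  define N where "N = length ts"
  obtain a b where ab: "\<And>n. t n \<le> a * n + b" using bigo_linear_bound[OF t] by blast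
  have "length As = N" by (simp add: As_def N_def)
  with wdec_word_problem[of As] obtain P where P: "wdec (\<lambda>z. P (pfst z) (psnd z))"
    "\<And>k x. x < N ^ k \<Longrightarrow> P k x \<longleftrightarrow> prodm As (digits N k x) = mat 1" by metis
  \<comment> \<open>Cutting off at \<open>N\<close> gives the form of \<open>wcomp_table\<close>; on
    paths with indices below \<open>N\<close> the folds are unchanged.\<close>
  define sc where "sc st i = (if i < N then step_code ts st i else 0)" for st i
  define rc where "rc w i = (if i < N then read_code ts w i else 0)" for w i
  define fin where "fin k x = foldl sc (Suc q0) (digits N k x)" for k x
  define wrd where "wrd k x = foldl rc 0 (rev (digits N k x))" for k x
  have accepts: "accepts_in \<delta> q0 Qa w k \<longleftrightarrow>
     (\<exists>x<N ^ k. (\<exists>j<length qs. fin k x = Suc (qs ! j)) \<and> wrd k x = list_encode w \<and> P k x)" for w k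
  proof -
    let ?A = "\<lambda>js. (\<exists>q\<in>Qa. foldl (step_code ts) (Suc q0) js = Suc q) \<and>
        foldr (\<lambda>i w. read_code ts w i) js 0 = list_encode w \<and> prodm As js = mat 1"
    have "accepts_in \<delta> q0 Qa w k \<longleftrightarrow> (\<exists>js. length js = k \<and> set js \<subseteq> {..<N} \<and> ?A js)"
      unfolding accepts_in_def ts[symmetric] comp_iff_path prodm_def As_def N_def by blast
    also have "\<dots> \<longleftrightarrow> (\<exists>x<N ^ k. ?A (digits N k x))"
      using digits_surj[of _ N] set_digits[of _ N k] length_digits[of N k] by metis
    also have "\<dots> \<longleftrightarrow> (\<exists>x<N ^ k. (\<exists>j<length qs. fin k x = Suc (qs ! j)) \<and> wrd k x = list_encode w \<and> P k x)"
    proof (intro ex_cong1 conj_cong refl)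
      fix x assume x: "x < N ^ k"
      have "foldl (step_code ts) q js = foldl sc q js" "foldr (\<lambda>i w. read_code ts w i) js 0 = foldr (\<lambda>i w. rc w i) js 0"
        if "set js \<subseteq> {..<N}" for q js
        using that by (induction js arbitrary: q) (auto simp: sc_def rc_def)
      from this[OF set_digits[OF x]]
      show "(\<exists>q\<in>Qa. foldl (step_code ts) (Suc q0) (digits N k x) = Suc q) \<longleftrightarrow> (\<exists>j<length qs. fin k x = Suc (qs ! j))"
        and "foldr (\<lambda>i w. read_code ts w i) (digits N k x) 0 = list_encode w \<longleftrightarrow> wrd k x = list_encode w"
        by (auto simp: fin_def wrd_def foldl_conv_foldr qs[symmetric] in_set_conv_nth)
      show "prodm As (digits N k x) = mat 1 \<longleftrightarrow> P k x" using P(2)[OF x] by simp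
    qed
    finally show ?thesis .
  qed
  \<comment> \<open>Every search is bounded: the code \<open>c\<close> bounds the number
    \<open>k\<close> of steps, and \<open>N ^ k\<close> counts the candidate paths of length
    \<open>k\<close>. Runs longer than \<open>t\<close> allows do no harm, as any accepting run
    proves membership.\<close>
  have L_iff: "c \<in> list_encode ` L \<longleftrightarrow> (\<exists>k<Suc (a * c + b). \<exists>x<N ^ k.
      (\<exists>j<length qs. fin k x = Suc (qs ! j)) \<and> wrd k x = c \<and> P k x)" for c
  proof -
    obtain w where w: "c = list_encode w" by (metis list_decode_inverse)
    have "c \<in> list_encode ` L \<longleftrightarrow> w \<in> L" by (simp add: w inj_image_mem_iff[OF inj_list_encode])
    also have "\<dots> \<longleftrightarrow> (\<exists>k<Suc (a * c + b). accepts_in \<delta> q0 Qa w k)"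
    proof
      assume "w \<in> L"
      then obtain k where k: "k \<le> t (length w)" "accepts_in \<delta> q0 Qa w k"
        using bound unfolding weakly_time_bounded_def L by blast
      have "k \<le> a * length w + b" using k(1) ab order_trans by blast
      also have "\<dots> \<le> a * c + b" using length_le_list_encode[of w] by (simp add: w)
      finally show "\<exists>k<Suc (a * c + b). accepts_in \<delta> q0 Qa w k" using k(2) by (auto simp: less_Suc_eq_le)
    qed (auto simp: L lang_def)
    finally show ?thesis unfolding accepts by (simp add: w)
  qed
  have "wcomp (\<lambda>z. sc (pfst z) (psnd z))"
  proof -
    have "wcomp (\<lambda>z. step_code ts (pfst z) i)" for i
      unfolding step_code_def by (intro wcomp_intros)
    from wcomp_table[of N "\<lambda>i z. step_code ts (pfst z) i", OF this wcomp_psnd[OF wcomp_id]]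
    show ?thesis by (simp add: sc_def)
  qed
  from wcomp_foldl_digits(1)[OF this] have fin: "wcomp (\<lambda>z. fin (pfst z) (psnd z))"
    by (simp add: fin_def)
  have "wcomp (\<lambda>z. rc (pfst z) (psnd z))"
  proof -
    have "wcomp (\<lambda>z. read_code ts (pfst z) i)" for i
      unfolding read_code_def by (cases "fst (snd (ts ! i))") (auto intro!: wcomp_intros)
    from wcomp_table[of N "\<lambda>i z. read_code ts (pfst z) i", OF this wcomp_psnd[OF wcomp_id]]
    show ?thesis by (simp add: rc_def)
  qed
  from wcomp_foldl_digits(2)[OF this] have wrd: "wcomp (\<lambda>z. wrd (pfst z) (psnd z))"
    by (simp add: wrd_def)
  have qs_table: "wdec (\<lambda>z. \<exists>j<length qs. f z = Suc (qs ! j))" if "wcomp f" for f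
  proof -
    have "wdec (\<lambda>z. \<not> (\<forall>j<length qs. f z \<noteq> Suc (qs ! j)))"
      by (intro wdec_not wdec_All_less wdec_eq that wcomp_const)
    then show ?thesis by simp
  qed
  show ?thesis unfolding L_iff
    by (intro wdec_bex wdec_conj wdec_eq qs_table wcomp_comp2[OF fin] wcomp_comp2[OF wrd]
        wdec_comp2[OF P(1)] wcomp_intros)
qed

lemma lang_subset_lists:
  assumes "G_automaton G Q \<Sigma> \<delta> q0 Qa" shows "lang \<delta> q0 Qa \<subseteq> lists \<Sigma>"
proof -
  have "comp \<delta> q x w q' y k \<Longrightarrow> w \<in> lists \<Sigma>" for q x w q' y k
    by (induction rule: comp.induct) (use assms in \<open>auto simp: G_automaton_def\<close>)
  then show ?thesis unfolding lang_def accepts_in_def by blast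
qed

theorem theorem4p14:
  fixes G :: "(complex ^'n ^'n) set"
  assumes "matrix_group G" and "computable_entries G"
  shows "lin_time_class G \<subset> RE_class"
proof
  show "lin_time_class G \<subseteq> RE_class"
  proof (intro subrelI)
    fix \<Sigma> L assume L: "(\<Sigma>, L) \<in> lin_time_class G"
    then obtain Q \<delta> q0 Qa where aut: "G_automaton G Q \<Sigma> \<delta> q0 Qa" and lang: "L = lang \<delta> q0 Qa"
      unfolding lin_time_class_def by blast
    have "finite \<Sigma>" using aut by (simp add: G_automaton_def)
    moreover have "L \<subseteq> lists \<Sigma>" unfolding lang by (rule lang_subset_lists[OF aut])
    moreover have "re_set (list_encode ` L)"
      using re_set_wdec[OF wdec_lin_time[OF L]] by simp
    ultimately show "(\<Sigma>, L) \<in> RE_class" by (simp add: RE_class_def)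
  qed
  show "lin_time_class G \<noteq> RE_class"
    using halting_lang_RE halting_lang_undecidable wdec_lin_time by blast
qed

end
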